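(* Let $B\subset\mathbb R^3$ be the unit ball and let $\Sigma$ be an immersed, simply connected or doubly connected minimal surface in $B$. If $\Sigma$ is simply connected, assume that $\gamma:=\partial\Sigma\cap\partial B$ is connected and immersed, and that $\Sigma\cup\gamma$ is $C^1$ such that $\Sigma$ is perpendicular to $\partial B$ along $\gamma$ (that is, $\gamma$ is a free boundary of $\Sigma$ in $B$). If $\Sigma$ is doubly connected, assume that $\gamma$ is one of the two boundary components of $\Sigma$, and that $\gamma$ is a free boundary of $\Sigma$ in $B$, i.e. $\gamma\subset\partial B$ and $\Sigma$ is perpendicular to $\partial B$ along $\gamma$. (a) Then there exists a minimal surface $\Sigma^{double}\supset\Sigma$ that is an analytic continuation of $\Sigma$ across $\gamma$ such that $\Sigma^*:=\Sigma^{double}\setminus\overline{\Sigma}$ is conformally equivalent to $\Sigma$ (up to punctures, as specified in (c)). (b) The surface $\Sigma^*$ is called the spherical mirror image of $\Sigma$ across $\partial B$. (c) $\Sigma^*$ may have ends, and in this case $\Sigma^*$ is conformally equivalent to $\Sigma$ with punctures. (d) Similarly, let $\Sigma$ be an immersed, simply connected or doubly connected minimal surface outside $B$ with a free boundary $\gamma$ in $\partial B$, meaning: if $\Sigma$ is simply connected, $\gamma:=\partial\Sigma\cap\partial B$ is connected and immersed, and $\Sigma\cup\gamma$ is $C^1$ such that $\Sigma$ is perpendicular to $\partial B$ along $\gamma$; if $\Sigma$ is doubly connected, $\gamma$ is one of the two boundary components of $\Sigma$, $\gamma\subset\partial B$, and $\Sigma$ is perpendicular to $\partial B$ along $\gamma$.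 Then $\Sigma$ can be reflected across $\partial B$, i.e. there exists a minimal surface $\Sigma^{double}\supset\Sigma$ that is an analytic continuation of $\Sigma$ across $\gamma$ such that $\Sigma^*:=\Sigma^{double}\setminus\overline{\Sigma}$ is conformally equivalent to $\Sigma$, except that $\Sigma^*$ may have ends, in which case $\Sigma^*$ is conformally equivalent to $\Sigma$ with punctures.
   Context: Minimal surfaces are described by conformal harmonic maps. If $\Sigma$ is simply connected, take a conformal harmonic map $\Psi:D\to\Sigma$ from the half disk $D=\{(x,y):x^2+y^2<1,\ 0<y\}$ with $\gamma=\Psi(\delta)$, $\delta=\{(x,0):-1<x<1\}$. If $\Sigma$ is doubly connected (an annulus), take $D=\mathbb R\times(0,a)$ for some $a>0$, $\delta=\mathbb R\times\{0\}$, and $\Psi$ a conformal harmonic map onto $\Sigma$, periodic in $x$, with $\gamma=\Psi(\delta)$. Let $D^*$ be the mirror image of $D$ across the $x$-axis. An analytic continuation $\Sigma^{double}$ of $\Sigma$ across $\gamma$ is the image of a conformal harmonic map $\Psi^1$ on $D\cup\delta\cup D^*$ (with a set of points of $D^*$, called punctures, possibly removed) that extends $\Psi$ (and is periodic in $x$ with the same period in the doubly connected case). Surfaces are understood as parametrized (immersed) surfaces, so that $\Sigma^{double}\setminus\overline\Sigma$ is the part $\Psi^1(D^* )$ of the surface parametrized by $D^*$ (minus punctures). "$\Sigma$ with punctures" means $\Sigma$ with a set of points deleted; the ends of $\Sigma^*$ correspond to punctures. *)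

theory Defs
  imports "HOL-Analysis.Analysis"
begin

text \<open>
  A surface is a parametrized one: a map from a plane domain (a subset of \<^typ>\<open>complex\<close>) to
  \<^typ>\<open>real^3\<close>. An annulus is the quotient of a strip by \<open>z \<mapsto> z + T\<close>; the simply connected case
  is treated simultaneously by setting \<open>T = 0\<close>, which makes all periodicity conditions void.
\<close>

type_synonym surface = "complex set \<times> (complex \<Rightarrow> real^3)"

section \<open>Conformal harmonic maps\<close>

definition dx :: "(complex \<Rightarrow> real^3) \<Rightarrow> complex \<Rightarrow> real^3" where
  "dx f z = frechet_derivative f (at z) 1"

definition dy :: "(complex \<Rightarrow> real^3) \<Rightarrow> complex \<Rightarrow> real^3" where
  "dy f z = frechet_derivative f (at z) \<i>"

definition C1_map_on :: "(complex \<Rightarrow> real^3) \<Rightarrow> complex set \<Rightarrow> bool" where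
  "C1_map_on f S \<longleftrightarrow>
     open S \<and> f differentiable_on S \<and> continuous_on S (dx f) \<and> continuous_on S (dy f)"

definition harmonic_map_on :: "(complex \<Rightarrow> real^3) \<Rightarrow> complex set \<Rightarrow> bool" where
  "harmonic_map_on f S \<longleftrightarrow>
     C1_map_on f S \<and> C1_map_on (dx f) S \<and> C1_map_on (dy f) S \<and>
     (\<forall>z\<in>S. dx (dx f) z + dy (dy f) z = 0)"

text \<open>Conformality is meant in the strict sense, without branch points: the map is an immersion.\<close>

definition conformal_immersion_on :: "(complex \<Rightarrow> real^3) \<Rightarrow> complex set \<Rightarrow> bool" where
  "conformal_immersion_on f S \<longleftrightarrow>
     (\<forall>z\<in>S. dx f z \<noteq> 0 \<and> norm (dx f z) = norm (dy f z) \<and> dx f z \<bullet> dy f z = 0)"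

definition minimal_immersion_on :: "(complex \<Rightarrow> real^3) \<Rightarrow> complex set \<Rightarrow> bool" where
  "minimal_immersion_on f S \<longleftrightarrow> harmonic_map_on f S \<and> conformal_immersion_on f S"

definition periodic_on :: "real \<Rightarrow> (complex \<Rightarrow> real^3) \<Rightarrow> complex set \<Rightarrow> bool" where
  "periodic_on T f S \<longleftrightarrow>
     (\<lambda>z. z + of_real T) ` S = S \<and> (\<forall>z\<in>S. f (z + of_real T) = f z)"

section \<open>Minimal surfaces with free boundary on the unit sphere\<close>

definition half_disk :: "complex set" where
  "half_disk = {z. cmod z < 1 \<and> 0 < Im z}"

definition half_disk_diameter :: "complex set" where
  "half_disk_diameter = {z. cmod z < 1 \<and> Im z = 0}"

definition strip :: "real \<Rightarrow> complex set" where
  "strip a = {z. 0 < Im z \<and> Im z < a}"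

definition strip_bottom :: "complex set" where
  "strip_bottom = {z. Im z = 0}"

text \<open>
  \<open>\<Psi>\<close> is \<open>C\<^sup>1\<close> up to \<open>\<delta>\<close>, with partial derivatives \<open>U\<close>, \<open>V\<close> (one-sided in the \<open>y\<close>-direction
  on \<open>\<delta>\<close>), and \<open>\<gamma> = \<Psi>(\<delta>)\<close> is an immersed curve on the sphere. The surface is perpendicular to the
  sphere at \<open>\<Psi> z\<close> iff its tangent plane there contains the normal of the sphere, which is \<open>\<Psi> z\<close>.
\<close>

definition free_boundary ::
    "complex set \<Rightarrow> complex set \<Rightarrow> (complex \<Rightarrow> real^3) \<Rightarrow> bool" where
  "free_boundary D \<delta> \<Psi> \<longleftrightarrow>
     (\<exists>U V. continuous_on (D \<union> \<delta>) U \<and> continuous_on (D \<union> \<delta>) V \<and>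
        (\<forall>z\<in>D \<union> \<delta>. (\<Psi> has_derivative (\<lambda>h. Re h *\<^sub>R U z + Im h *\<^sub>R V z)) (at z within D \<union> \<delta>)) \<and>
        (\<forall>z\<in>\<delta>. \<Psi> z \<in> sphere 0 1 \<and> U z \<noteq> 0 \<and> \<Psi> z \<in> span {U z, V z}))"

text \<open>The boundary \<open>\<partial>\<Sigma>\<close>: all limits of \<open>\<Psi>\<close> along sequences tending to the frontier of the domain.\<close>

definition surface_boundary :: "complex set \<Rightarrow> (complex \<Rightarrow> real^3) \<Rightarrow> (real^3) set" where
  "surface_boundary D \<Psi> =
     {p. \<exists>s \<zeta>. range s \<subseteq> D \<and> \<zeta> \<in> frontier D \<and> s \<longlonglongrightarrow> \<zeta> \<and> (\<lambda>n. \<Psi> (s n)) \<longlonglongrightarrow> p}"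

text \<open>
  As \<open>\<delta>\<close> is an open segment, \<open>\<gamma> = \<partial>\<Sigma> \<inter> \<partial>B\<close> is required up to the end points of \<open>\<gamma>\<close>;
  the inclusion of \<open>\<gamma>\<close> in \<open>\<partial>\<Sigma> \<inter> \<partial>B\<close> follows from continuity.
\<close>

definition simply_connected_free_boundary :: "(complex \<Rightarrow> real^3) \<Rightarrow> bool" where
  "simply_connected_free_boundary \<Psi> \<longleftrightarrow>
     minimal_immersion_on \<Psi> half_disk \<and>
     free_boundary half_disk half_disk_diameter \<Psi> \<and>
     surface_boundary half_disk \<Psi> \<inter> sphere 0 1 \<subseteq> closure (\<Psi> ` half_disk_diameter)"

definition doubly_connected_free_boundary ::
    "real \<Rightarrow> real \<Rightarrow> (complex \<Rightarrow> real^3) \<Rightarrow> bool" where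
  "doubly_connected_free_boundary a T \<Psi> \<longleftrightarrow>
     0 < a \<and> 0 < T \<and>
     minimal_immersion_on \<Psi> (strip a) \<and>
     periodic_on T \<Psi> (strip a \<union> strip_bottom) \<and>
     free_boundary (strip a) strip_bottom \<Psi>"

definition free_boundary_minimal_surface ::
    "complex set \<Rightarrow> complex set \<Rightarrow> real \<Rightarrow> (complex \<Rightarrow> real^3) \<Rightarrow> bool" where
  "free_boundary_minimal_surface D \<delta> T \<Psi> \<longleftrightarrow>
     (D = half_disk \<and> \<delta> = half_disk_diameter \<and> T = 0 \<and> simply_connected_free_boundary \<Psi>) \<or>
     (\<exists>a. D = strip a \<and> \<delta> = strip_bottom \<and> doubly_connected_free_boundary a T \<Psi>)"

section \<open>Analytic continuation, punctures and ends\<close>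

text \<open>Punctures are isolated, and on an annulus they are points of the quotient.\<close>

definition punctures :: "real \<Rightarrow> complex set \<Rightarrow> complex set \<Rightarrow> bool" where
  "punctures T E P \<longleftrightarrow>
     P \<subseteq> E \<and> (\<forall>z\<in>E. \<not> z islimpt P) \<and> (\<lambda>z. z + of_real T) ` P = P"

text \<open>
  The mirror image \<open>D\<^sup>*\<close> is \<open>cnj ` D\<close>. Minimality on \<open>D \<union> \<delta> \<union> (D\<^sup>* - P)\<close> includes that this set is
  open, so the punctures do not accumulate at \<open>\<delta>\<close>.
\<close>

definition analytic_continuation ::
    "complex set \<Rightarrow> complex set \<Rightarrow> real \<Rightarrow> (complex \<Rightarrow> real^3) \<Rightarrow>
     complex set \<Rightarrow> (complex \<Rightarrow> real^3) \<Rightarrow> bool" where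
  "analytic_continuation D \<delta> T \<Psi> P \<Psi>1 \<longleftrightarrow>
     punctures T (cnj ` D) P \<and>
     minimal_immersion_on \<Psi>1 (D \<union> \<delta> \<union> (cnj ` D - P)) \<and>
     (\<forall>z\<in>D \<union> \<delta>. \<Psi>1 z = \<Psi> z) \<and>
     periodic_on T \<Psi>1 (D \<union> \<delta> \<union> (cnj ` D - P))"

definition end_at :: "(complex \<Rightarrow> real^3) \<Rightarrow> complex \<Rightarrow> bool" where
  "end_at f p \<longleftrightarrow> filterlim f at_infinity (at p)"

text \<open>The part of the continued surface that is parametrized by \<open>D\<^sup>*\<close> minus the punctures.\<close>

definition spherical_mirror_image ::
    "complex set \<Rightarrow> complex set \<Rightarrow> (complex \<Rightarrow> real^3) \<Rightarrow> surface" where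
  "spherical_mirror_image D P \<Psi>1 = (cnj ` D - P, \<Psi>1)"

definition with_punctures :: "surface \<Rightarrow> complex set \<Rightarrow> surface" where
  "with_punctures \<Sigma> Q = (fst \<Sigma> - Q, snd \<Sigma>)"

text \<open>
  Conformal equivalence refers to the metrics induced from \<^typ>\<open>real^3\<close>; it may reverse orientation.
  The last condition makes the bijection descend to the quotients by \<open>z \<mapsto> z + T\<close>.
\<close>

definition conformally_equivalent :: "real \<Rightarrow> surface \<Rightarrow> surface \<Rightarrow> bool" where
  "conformally_equivalent T \<Sigma>1 \<Sigma>2 \<longleftrightarrow>
     (\<exists>\<phi>. homeomorphism (fst \<Sigma>1) (fst \<Sigma>2) \<phi> (inv_into (fst \<Sigma>1) \<phi>) \<and>
        (\<forall>z\<in>fst \<Sigma>1. \<exists>A c. (\<phi> has_derivative A) (at z) \<and> 0 < c \<and>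
           (\<forall>v w. frechet_derivative (snd \<Sigma>2) (at (\<phi> z)) (A v) \<bullet>
                  frechet_derivative (snd \<Sigma>2) (at (\<phi> z)) (A w) =
                  c * (frechet_derivative (snd \<Sigma>1) (at z) v \<bullet>
                       frechet_derivative (snd \<Sigma>1) (at z) w))) \<and>
        ((\<forall>z\<in>fst \<Sigma>1. \<phi> (z + of_real T) = \<phi> z + of_real T) \<or>
         (\<forall>z\<in>fst \<Sigma>1. \<phi> (z + of_real T) = \<phi> z - of_real T)))"

end

theory Submission
  imports Defs "HOL-Complex_Analysis.Complex_Analysis"
begin

text \<open>
  Write \<open>\<Psi> = Re F\<close> with a null curve \<open>F\<close>, \<open>f = F' = \<Psi>\<^sub>x - i \<Psi>\<^sub>y\<close>. On \<open>\<delta>\<close> the free boundary condition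
  says \<open>\<Psi>\<^sub>y = \<lambda> \<Psi>\<close>, so the boundary curve \<open>\<gamma> = \<Psi>|\<delta>\<close> satisfies the differential equation
  \<open>\<gamma>' = f - (f \<bullet> \<gamma>) \<gamma>\<close> with the complex bilinear product. Its coefficients live on all of \<open>D\<close>, and it is a
  Riccati equation on the complex unit sphere: putting \<open>\<gamma> = p / s\<close> it becomes the linear system
  \<open>p' = s f\<close>, \<open>s' = f \<bullet> p\<close>, which preserves \<open>p \<bullet> p - s\<^sup>2\<close>. Hence \<open>p\<close> and \<open>s\<close> are holomorphic on \<open>D\<close> and
  \<open>\<gamma>\<close> extends meromorphically. The curve \<open>G = 2 \<gamma> - F\<close> is conjugate to \<open>F\<close> on \<open>\<delta>\<close>, so \<open>F\<close> continues
  across \<open>\<delta>\<close> by \<open>z \<mapsto> cnj (G (cnj z))\<close>. Since \<open>G' = f - 2 (f \<bullet> \<gamma>) \<gamma>\<close> is a complex reflection of \<open>f\<close>, the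
  continuation is again an unbranched conformal immersion; its punctures, the zeros of \<open>s\<close>, are ends because
  \<open>\<gamma> \<bullet> \<gamma> = 1\<close> forces \<open>|Re \<gamma>|\<close> to tend to infinity together with \<open>|\<gamma>|\<close>.
\<close>

section \<open>Symmetry of second derivatives\<close>

text \<open>The mean value theorem for t -> u(z + tv + hw) - u(z + tv) turns the second difference
  into \<open>h\<close> times an increment of \<open>\<lambda>x. L x v\<close>, and
  differentiability of that function at the single point \<open>z\<close> estimates the increment.
  Continuity of second derivatives does not enter.\<close>

lemma second_difference_estimate:
  fixes u :: "'a::real_normed_vector \<Rightarrow> real"
  assumes "open S" "z \<in> S"
    and u: "\<And>x. x \<in> S \<Longrightarrow> (u has_derivative L x) (at x)"
    and M: "((\<lambda>x. L x v) has_derivative M) (at z)"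
    and "0 < e"
  shows "\<exists>d>0. \<forall>h. 0 < h \<and> h < d \<longrightarrow>
    \<bar>u (z + h *\<^sub>R v + h *\<^sub>R w) - u (z + h *\<^sub>R v) - u (z + h *\<^sub>R w) + u z - h\<^sup>2 * M w\<bar> \<le> e * h\<^sup>2"
proof -
  \<comment> \<open>The factor 2 pays for two applications of the first-order estimate, at the
    points with and without \<open>h *\<^sub>R w\<close>; the summand 1 keeps \<open>k\<close>
    positive when \<open>v\<close> and \<open>w\<close> vanish.\<close>
  define k where "k = 2 * (norm v + norm w) + 1"
  have k: "k > 0"
    by (simp add: k_def add_nonneg_pos)
  interpret M: bounded_linear M
    using M has_derivative_bounded_linear by blast
  obtain r where r: "r > 0" "ball z r \<subseteq> S"
    using assms(1,2) openE by blast
  obtain d where d: "d > 0"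
    "\<And>x. norm (x - z) < d \<Longrightarrow> norm (L x v - L z v - M (x - z)) \<le> e / k * norm (x - z)"
    using M \<open>0 < e\<close> k unfolding has_derivative_at_alt
    by (metis divide_pos_pos)
  \<comment> \<open>For \<open>h < m\<close> the whole parallelogram spanned at \<open>z\<close> by
    \<open>h *\<^sub>R v\<close> and \<open>h *\<^sub>R w\<close> lies in \<open>S\<close> and
    within distance \<open>d\<close> of \<open>z\<close>.\<close>
  define m where "m = min r d / k"
  have "m > 0"
    using r d k by (simp add: m_def)
  moreover have "\<bar>u (z + h *\<^sub>R v + h *\<^sub>R w) - u (z + h *\<^sub>R v) - u (z + h *\<^sub>R w) + u z - h\<^sup>2 * M w\<bar>
      \<le> e * h\<^sup>2" if h: "0 < h" "h < m" for h
  proof -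
    have hk: "h * k < r" "h * k < d"
      using h k by (simp_all add: m_def pos_less_divide_eq)
    have nv: "norm (t *\<^sub>R v + h' *\<^sub>R w) \<le> h * (norm v + norm w)"
      if "0 \<le> t" "t \<le> h" "0 \<le> h'" "h' \<le> h" for t h'
    proof -
      have "norm (t *\<^sub>R v + h' *\<^sub>R w) \<le> t * norm v + h' * norm w"
        using that by (metis abs_of_nonneg norm_scaleR norm_triangle_ineq)
      also have "\<dots> \<le> h * norm v + h * norm w"
        using that by (intro add_mono mult_right_mono) auto
      finally show ?thesis
        by (simp add: algebra_simps)
    qed
    have hk': "h * (norm v + norm w) < h * k"
      using h by (simp add: k_def add_nonneg_pos)
    have inS: "z + t *\<^sub>R v + h' *\<^sub>R w \<in> S" if "0 \<le> t" "t \<le> h" "0 \<le> h'" "h' \<le> h" for t h'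
    proof -
      have "dist z (z + (t *\<^sub>R v + h' *\<^sub>R w)) < r"
        unfolding dist_norm norm_minus_commute[of z] add_diff_cancel_left'
        using nv[OF that] hk hk' by linarith
      then show ?thesis
        using r by (auto simp: add.assoc)
    qed
    define g where "g = (\<lambda>t. u (z + t *\<^sub>R v + h *\<^sub>R w) - u (z + t *\<^sub>R v))"
    have g: "(g has_real_derivative L (z + t *\<^sub>R v + h *\<^sub>R w) v - L (z + t *\<^sub>R v) v) (at t)"
      if t: "0 \<le> t" "t \<le> h" for t
    proof -
      interpret L1: bounded_linear "L (z + t *\<^sub>R v + h *\<^sub>R w)"
        using u inS[of t h] t h has_derivative_bounded_linear by force
      interpret L2: bounded_linear "L (z + t *\<^sub>R v)"
        using u inS[of t 0] t h has_derivative_bounded_linear by force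
      have 1: "((\<lambda>t. z + t *\<^sub>R v + h *\<^sub>R w) has_derivative (\<lambda>s. s *\<^sub>R v)) (at t)"
        "((\<lambda>t. z + t *\<^sub>R v) has_derivative (\<lambda>s. s *\<^sub>R v)) (at t)"
        by (auto intro!: derivative_eq_intros)
      have "(g has_derivative (\<lambda>s. L (z + t *\<^sub>R v + h *\<^sub>R w) (s *\<^sub>R v) - L (z + t *\<^sub>R v) (s *\<^sub>R v))) (at t)"
        unfolding g_def
        by (intro has_derivative_diff has_derivative_compose[OF 1(1) u] has_derivative_compose[OF 1(2) u])
          (use inS[of t h] inS[of t 0] t h in auto)
      moreover have "(\<lambda>s. L (z + t *\<^sub>R v + h *\<^sub>R w) (s *\<^sub>R v) - L (z + t *\<^sub>R v) (s *\<^sub>R v)) =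
          (*) (L (z + t *\<^sub>R v + h *\<^sub>R w) v - L (z + t *\<^sub>R v) v)"
        by (intro ext) (simp only: L1.scaleR L2.scaleR real_scaleR_def right_diff_distrib mult.commute)
      ultimately show ?thesis
        by (simp add: has_field_derivative_def)
    qed
    obtain t where t: "0 < t" "t < h"
      "g h - g 0 = (h - 0) * (L (z + t *\<^sub>R v + h *\<^sub>R w) v - L (z + t *\<^sub>R v) v)"
      using MVT2[OF h(1), of g "\<lambda>t. L (z + t *\<^sub>R v + h *\<^sub>R w) v - L (z + t *\<^sub>R v) v"] g by auto
    define E where "E = e / k * (h * (norm v + norm w))"
    have e1: "norm (L (z + t *\<^sub>R v + h' *\<^sub>R w) v - L z v - M (t *\<^sub>R v + h' *\<^sub>R w))
         \<le> E" if "0 \<le> h'" "h' \<le> h" for h'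
    proof -
      have n: "norm (t *\<^sub>R v + h' *\<^sub>R w) \<le> h * (norm v + norm w)"
        using nv t that by simp
      then have "norm ((z + t *\<^sub>R v + h' *\<^sub>R w) - z) < d"
        using hk hk' by (simp add: add.assoc)
      from d(2)[OF this] have "norm (L (z + t *\<^sub>R v + h' *\<^sub>R w) v - L z v - M (t *\<^sub>R v + h' *\<^sub>R w))
         \<le> e / k * norm (t *\<^sub>R v + h' *\<^sub>R w)"
        by (simp add: add.assoc)
      also have "\<dots> \<le> E"
        unfolding E_def using n k \<open>0 < e\<close> by (intro mult_left_mono) auto
      finally show ?thesis .
    qed
    have e2: "2 * E \<le> e * h"
    proof -
      have "2 * (norm v + norm w) \<le> k"
        by (simp add: k_def)
      then have "e * h * (2 * (norm v + norm w)) \<le> e * h * k"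
        using h \<open>0 < e\<close> by (intro mult_left_mono) auto
      then show ?thesis
        using k by (simp add: E_def field_simps)
    qed
    have "\<bar>L (z + t *\<^sub>R v + h *\<^sub>R w) v - L (z + t *\<^sub>R v) v - h * M w\<bar> \<le> e * h"
      using e1[of h] e1[of 0] e2 h
      by (simp add: M.add M.scaleR abs_le_iff)
    then have "h * \<bar>L (z + t *\<^sub>R v + h *\<^sub>R w) v - L (z + t *\<^sub>R v) v - h * M w\<bar> \<le> h * (e * h)"
      using h by (intro mult_left_mono) auto
    then have "\<bar>h * (L (z + t *\<^sub>R v + h *\<^sub>R w) v - L (z + t *\<^sub>R v) v - h * M w)\<bar> \<le> e * h\<^sup>2"
      using h by (simp only: abs_mult abs_of_pos power2_eq_square ac_simps)
    moreover have "u (z + h *\<^sub>R v + h *\<^sub>R w) - u (z + h *\<^sub>R v) - u (z + h *\<^sub>R w) + u z - h\<^sup>2 * M w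
        = h * (L (z + t *\<^sub>R v + h *\<^sub>R w) v - L (z + t *\<^sub>R v) v - h * M w)"
      using t(3) unfolding g_def by (simp add: power2_eq_square algebra_simps)
    ultimately show ?thesis
      by simp
  qed
  ultimately show ?thesis
    by blast
qed

text \<open>The second difference is symmetric in \<open>v\<close> and \<open>w\<close>;
  approximating it in both orders and dividing by \<open>h\<^sup>2\<close> forces equality.\<close>

lemma mixed_derivatives_eq:
  fixes u :: "'a::real_normed_vector \<Rightarrow> real"
  assumes "open S" "z \<in> S"
    and "\<And>x. x \<in> S \<Longrightarrow> (u has_derivative L x) (at x)"
    and "((\<lambda>x. L x v) has_derivative M) (at z)"
    and "((\<lambda>x. L x w) has_derivative N) (at z)"
  shows "M w = N v"
proof (rule ccontr)
  assume "M w \<noteq> N v"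
  \<comment> \<open>One third of the gap: the two errors add up to at most \<open>2 * e\<close>,
    which is less than the gap \<open>3 * e\<close>.\<close>
  define e where "e = \<bar>M w - N v\<bar> / 3"
  have e: "e > 0"
    using \<open>M w \<noteq> N v\<close> by (simp add: e_def)
  obtain d1 where d1: "d1 > 0" "\<And>h. 0 < h \<and> h < d1 \<Longrightarrow>
    \<bar>u (z + h *\<^sub>R v + h *\<^sub>R w) - u (z + h *\<^sub>R v) - u (z + h *\<^sub>R w) + u z - h\<^sup>2 * M w\<bar> \<le> e * h\<^sup>2"
    using second_difference_estimate[OF assms(1,2,3,4) e, of w] by auto
  obtain d2 where d2: "d2 > 0" "\<And>h. 0 < h \<and> h < d2 \<Longrightarrow>
    \<bar>u (z + h *\<^sub>R w + h *\<^sub>R v) - u (z + h *\<^sub>R w) - u (z + h *\<^sub>R v) + u z - h\<^sup>2 * N v\<bar> \<le> e * h\<^sup>2"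
    using second_difference_estimate[OF assms(1,2,3,5) e, of v] by auto
  define h where "h = min d1 d2 / 2"
  have h: "0 < h" "h < d1" "h < d2"
    using d1(1) d2(1) by (auto simp: h_def)
  define X where "X = u (z + h *\<^sub>R v + h *\<^sub>R w) - u (z + h *\<^sub>R v) - u (z + h *\<^sub>R w) + u z"
  have "\<bar>X - h\<^sup>2 * M w\<bar> \<le> e * h\<^sup>2" "\<bar>X - h\<^sup>2 * N v\<bar> \<le> e * h\<^sup>2"
    using d1(2)[of h] d2(2)[of h] h unfolding X_def by (simp_all add: algebra_simps)
  then have "\<bar>h\<^sup>2 * M w - h\<^sup>2 * N v\<bar> \<le> h\<^sup>2 * (2 * e)"
    by (simp add: algebra_simps)
  then have "h\<^sup>2 * \<bar>M w - N v\<bar> \<le> h\<^sup>2 * (2 * e)"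
    by (simp add: abs_mult flip: right_diff_distrib)
  then have "\<bar>M w - N v\<bar> \<le> 2 * e"
    using h by simp
  then show False
    using e by (simp add: e_def)
qed

section \<open>Linear holomorphic differential equations\<close>

lemma finite_family_bounded:
  fixes f :: "'i::finite \<Rightarrow> 'a::topological_space \<Rightarrow> 'b::real_normed_vector"
  assumes "compact L" "\<And>i. continuous_on L (f i)"
  obtains M where "0 \<le> M" "\<And>i x. x \<in> L \<Longrightarrow> norm (f i x) \<le> M"
proof -
  have "bounded (\<Union>i. f i ` L)"
    using assms by (intro bounded_UN) (auto intro: compact_imp_bounded compact_continuous_image)
  then obtain M where "M > 0" "\<forall>y\<in>(\<Union>i. f i ` L). norm y \<le> M"
    unfolding bounded_pos by (elim exE conjE)
  then show thesis
    by (intro that[of M]) auto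
qed

text \<open>On the segment from \<open>a\<close> to \<open>z\<close>, \<open>g\<close> is dominated
  by a multiple of t^(n+1)/(n+1). One integration raises the order of vanishing at \<open>a\<close>
  by one and contributes the divisor \<open>Suc n\<close>, the source of the factorial below.
  Derivatives are taken within \<open>K\<close>, so \<open>K\<close> may be a segment or contain
  boundary points.\<close>

lemma linear_ode_step:
  fixes A :: "'n::finite \<Rightarrow> 'n \<Rightarrow> complex \<Rightarrow> complex" and M C :: real
  assumes "convex K" "a \<in> K" "z \<in> K" and "g a = 0"
    and g: "\<And>z. z \<in> K \<Longrightarrow> (g has_field_derivative (\<Sum>k\<in>UNIV. A j k z * h k z)) (at z within K)"
    and A: "\<And>k z. z \<in> K \<Longrightarrow> norm (A j k z) \<le> M"
    and h: "\<And>k z. z \<in> K \<Longrightarrow> norm (h k z) \<le> C * norm (z - a) ^ n"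
    and "0 \<le> M" "0 \<le> C"
  shows "norm (g z) \<le> C * (CARD('n) * M) * norm (z - a) ^ Suc n / Suc n"
proof -
  define l where "l = linepath a z"
  define B where "B = C * (CARD('n) * M) * norm (z - a) ^ Suc n"
  have lK: "l t \<in> K" if "t \<in> {0..1}" for t
    using that assms(1-3) unfolding l_def
    by (metis closed_segment_subset imageI linepath_image_01 subsetD)
  have la: "l t - a = t *\<^sub>R (z - a)" for t
    by (simp add: l_def linepath_def algebra_simps)
  have dl: "((g \<circ> l) has_vector_derivative (z - a) * (\<Sum>k\<in>UNIV. A j k (l t) * h k (l t))) (at t within {0..1})"
    if "t \<in> {0..1}" for t
  proof (rule field_vector_diff_chain_within)
    show "(l has_vector_derivative (z - a)) (at t within {0..1})"
      unfolding l_def by (rule has_vector_derivative_linepath_within)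
    show "(g has_field_derivative (\<Sum>k\<in>UNIV. A j k (l t) * h k (l t))) (at (l t) within l ` {0..1})"
      using g[OF lK[OF that]] by (rule DERIV_subset) (use lK in auto)
  qed
  have "norm ((g \<circ> l) 1 - (g \<circ> l) 0) \<le> (\<lambda>t. B * t ^ Suc n / Suc n) 1 - (\<lambda>t. B * t ^ Suc n / Suc n) 0"
  proof (rule differentiable_bound_general)
    show "continuous_on {0..1} (g \<circ> l)"
      using dl by (meson continuous_on_eq_continuous_within has_vector_derivative_continuous)
    show "continuous_on {0..1} (\<lambda>t. B * t ^ Suc n / Suc n)"
      by (intro continuous_intros) auto
    fix t :: real assume t: "0 < t" "t < 1"
    then have "at t within {0..1} = at t"
      by (rule at_within_Icc_at)
    then show "((g \<circ> l) has_vector_derivative (z - a) * (\<Sum>k\<in>UNIV. A j k (l t) * h k (l t))) (at t)"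
      using dl[of t] t by (simp only: atLeastAtMost_iff less_imp_le simp_thms)
    have "((\<lambda>t. B * t ^ Suc n / Suc n) has_real_derivative B * t ^ n) (at t)"
      by (auto intro!: derivative_eq_intros simp del: power_Suc) 
    then show "((\<lambda>t. B * t ^ Suc n / Suc n) has_vector_derivative B * t ^ n) (at t)"
      by (simp add: has_real_derivative_iff_has_vector_derivative)
    have "norm (\<Sum>k\<in>UNIV. A j k (l t) * h k (l t)) \<le> (\<Sum>k\<in>(UNIV::'n set). M * (C * norm (l t - a) ^ n))"
      using A[OF lK] h[OF lK] t assms(8,9)
      by (intro sum_norm_le) (auto simp: norm_mult intro!: mult_mono)
    also have "\<dots> = C * (CARD('n) * M) * (t ^ n * norm (z - a) ^ n)"
      using t by (simp add: la power_mult_distrib)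
    finally have "norm (z - a) * norm (\<Sum>k\<in>UNIV. A j k (l t) * h k (l t)) \<le> norm (z - a) * (C * (CARD('n) * M) * (t ^ n * norm (z - a) ^ n))"
      by (intro mult_left_mono) auto
    then show "norm ((z - a) * (\<Sum>k\<in>UNIV. A j k (l t) * h k (l t))) \<le> B * t ^ n"
      unfolding norm_mult B_def by (simp add: ac_simps)
  qed auto
  then show ?thesis
    using \<open>g a = 0\<close> by (simp add: l_def linepath_def B_def)
qed

text \<open>Stated for a sequence of families so as to serve twice: for a constant sequence, giving
  uniqueness, and for the differences of successive Picard iterates, giving convergence.\<close>

lemma iterated_linear_ode_estimate:
  fixes A :: "'n::finite \<Rightarrow> 'n \<Rightarrow> complex \<Rightarrow> complex" and M C :: real
  assumes "convex K" "a \<in> K" "z \<in> K"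
    and g: "\<And>n j z. z \<in> K \<Longrightarrow>
      (g (Suc n) j has_field_derivative (\<Sum>k\<in>UNIV. A j k z * g n k z)) (at z within K)"
    and ga: "\<And>n j. g (Suc n) j a = 0"
    and A: "\<And>j k z. z \<in> K \<Longrightarrow> norm (A j k z) \<le> M"
    and C: "\<And>j z. z \<in> K \<Longrightarrow> norm (g 0 j z) \<le> C"
    and "0 \<le> M" "0 \<le> C"
  shows "norm (g n j z) \<le> C * (CARD('n) * M * norm (z - a)) ^ n / fact n"
  using \<open>z \<in> K\<close>
proof (induction n arbitrary: j z)
  case 0
  then show ?case
    using C by simp
next
  case (Suc n)
  define B where "B = C * (CARD('n) * M) ^ n / fact n"
  have "norm (g (Suc n) j z) \<le> B * (CARD('n) * M) * norm (z - a) ^ Suc n / Suc n"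
  proof (rule linear_ode_step[OF assms(1,2) Suc.prems ga g A])
    show "norm (g n k z) \<le> B * norm (z - a) ^ n" if "z \<in> K" for k z
      using Suc.IH[OF that] by (simp add: B_def power_mult_distrib ac_simps)
    show "0 \<le> B"
      using assms by (simp add: B_def)
  qed (use assms in auto)
  then show ?case
    by (simp add: B_def power_mult_distrib ac_simps)
qed

text \<open>A solution with zero initial value is its own Picard iterate, so the bound with n! in
  the denominator holds for every \<open>n\<close> and tends to 0. The argument also covers sets
  with empty interior, such as the segment or line \<delta>.\<close>

lemma linear_ode_unique:
  fixes A :: "'n::finite \<Rightarrow> 'n \<Rightarrow> complex \<Rightarrow> complex"
  assumes "convex K" "a \<in> K" "z \<in> K"
    and w: "\<And>j z. z \<in> K \<Longrightarrow> (w j has_field_derivative (\<Sum>k\<in>UNIV. A j k z * w k z)) (at z within K)"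
    and wa: "\<And>j. w j a = 0"
    and A: "\<And>j k. continuous_on K (A j k)"
  shows "w j z = 0"
proof -
  \<comment> \<open>Coefficients and solution are known to be continuous on \<open>K\<close>; on the
    compact segment they are bounded.\<close>
  define L where "L = closed_segment a z"
  have L: "L \<subseteq> K" "compact L" "convex L" "a \<in> L" "z \<in> L"
    using assms(1-3) by (auto simp: L_def closed_segment_subset)
  obtain M where M: "0 \<le> M" "\<And>jk x. x \<in> L \<Longrightarrow> norm (A (fst jk) (snd jk) x) \<le> M"
    using finite_family_bounded[OF L(2), of "\<lambda>jk. A (fst jk) (snd jk)"]
      continuous_on_subset[OF A L(1)] by auto
  obtain C where C: "0 \<le> C" "\<And>j x. x \<in> L \<Longrightarrow> norm (w j x) \<le> C"
    using finite_family_bounded[OF L(2), of w]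
      continuous_on_subset[OF DERIV_continuous_on[OF w] L(1)] by auto
  define q where "q = CARD('n) * M * norm (z - a)"
  have "norm (w j z) \<le> C * q ^ n / fact n" for n
    unfolding q_def
  proof (rule iterated_linear_ode_estimate[where K = L and g = "\<lambda>n. w" and A = A])
    show "(w j has_field_derivative (\<Sum>k\<in>UNIV. A j k z * w k z)) (at z within L)" if "z \<in> L" for j z
      using w L that by (meson DERIV_subset subsetD)
  qed (use L M(1) M(2)[of _ "(_, _)"] C wa in auto)
  moreover have "(\<lambda>n. C * q ^ n / fact n) \<longlonglongrightarrow> 0"
    using tendsto_mult_right_zero[OF summable_LIMSEQ_zero[OF summable_exp[of q]], of C]
    by (simp add: field_simps)
  ultimately have "norm (w j z) \<le> 0"
    by (intro LIMSEQ_le_const[where X = "\<lambda>n. C * q ^ n / fact n"]) auto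
  then show ?thesis
    by simp
qed

text \<open>Each iterate is obtained as a primitive on the convex set \<open>K\<close>; a primitive
  exists because the integrand is continuous on \<open>K\<close> and holomorphic in its
  interior.\<close>

lemma picard_iterates_exist:
  fixes A :: "'n::finite \<Rightarrow> 'n \<Rightarrow> complex \<Rightarrow> complex"
  assumes "convex K" "a \<in> K"
    and contA: "\<And>j k. continuous_on K (A j k)"
    and holA: "\<And>j k. A j k holomorphic_on interior K"
  obtains W where "\<And>n j. W n j a = w0 j" "\<And>n j. continuous_on K (W n j)"
    "\<And>n j z. z \<in> K \<Longrightarrow>
      (W (Suc n) j has_field_derivative (\<Sum>k\<in>UNIV. A j k z * W n k z)) (at z within K)"
proof -
  \<comment> \<open>The invariant of the recursion: it makes the next integrand admissible and fixes
    the value at \<open>a\<close>.\<close>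
  define good where "good w \<longleftrightarrow>
    (\<forall>j::'n. w j a = w0 j \<and> continuous_on K (w j) \<and> w j holomorphic_on interior K)" for w
  define deriv_rel where "deriv_rel w w' \<longleftrightarrow> (\<forall>j. \<forall>z\<in>K.
    (w' j has_field_derivative (\<Sum>k\<in>UNIV. A j k z * w k z)) (at z within K))" for w w'
  have step: "\<exists>w'. good w' \<and> deriv_rel w w'" if "good w" for w
  proof -
    have prim: "\<exists>g. g a = w0 j \<and> (\<forall>z\<in>K. (g has_field_derivative (\<Sum>k\<in>UNIV. A j k z * w k z)) (at z within K))" for j
    proof -
      have hol: "(\<lambda>z. \<Sum>k\<in>UNIV. A j k z * w k z) holomorphic_on interior K"
        using that holA by (auto simp: good_def intro!: holomorphic_intros)
      have cont: "continuous_on K (\<lambda>z. \<Sum>k\<in>UNIV. A j k z * w k z)"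
        using that contA by (auto simp: good_def intro!: continuous_intros)
      obtain g where g: "\<And>z. z \<in> K \<Longrightarrow>
          (g has_field_derivative (\<Sum>k\<in>UNIV. A j k z * w k z)) (at z within K)"
        by (rule holomorphic_convex_primitive[OF \<open>convex K\<close> finite.emptyI cont])
          (use holomorphic_on_imp_differentiable_at[OF hol] in auto)
      show ?thesis
        by (rule exI[of _ "\<lambda>z. g z + (w0 j - g a)"]) (auto intro!: derivative_eq_intros g)
    qed
    then have "\<forall>j. \<exists>g. g a = w0 j \<and> (\<forall>z\<in>K. (g has_field_derivative (\<Sum>k\<in>UNIV. A j k z * w k z)) (at z within K))"
      by blast
    then obtain w' where w': "\<And>j. w' j a = w0 j"
      "\<And>j z. z \<in> K \<Longrightarrow> (w' j has_field_derivative (\<Sum>k\<in>UNIV. A j k z * w k z)) (at z within K)"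
      by metis
    have "w' j holomorphic_on interior K" for j
      unfolding holomorphic_on_def field_differentiable_def
      using w'(2) interior_subset by (blast intro: DERIV_subset)
    moreover have "continuous_on K (w' j)" for j
      by (rule DERIV_continuous_on) (rule w'(2))
    ultimately have "good w'"
      using w'(1) unfolding good_def by blast
    then show ?thesis
      using w'(2) unfolding deriv_rel_def by blast
  qed
  have "good (\<lambda>j z. w0 j)"
    by (simp add: good_def)
  then obtain W where W: "\<And>n. good (W n)" "\<And>n. deriv_rel (W n) (W (Suc n))"
    using dependent_nat_choice[of "\<lambda>_. good" "\<lambda>_. deriv_rel"] step by blast
  show thesis
    by (rule that[of W]) (use W in \<open>auto simp: good_def deriv_rel_def\<close>)
qed

text \<open>The Picard iterates converge uniformly on compact convex subsets of \<open>K\<close>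
  containing \<open>a\<close>, and hence so do their derivatives. Local compactness of
  \<open>K\<close>, the hypothesis \<open>loc\<close>, puts a relative neighbourhood of each point
  into such a subset.\<close>

lemma linear_ode_exists:
  fixes A :: "'n::finite \<Rightarrow> 'n \<Rightarrow> complex \<Rightarrow> complex"
  assumes "convex K" "a \<in> K"
    and loc: "\<And>z. z \<in> K \<Longrightarrow> \<exists>e>0. compact (K \<inter> cball z e)"
    and contA: "\<And>j k. continuous_on K (A j k)"
    and holA: "\<And>j k. A j k holomorphic_on interior K"
  obtains w where "\<And>j. w j a = w0 j"
    "\<And>j z. z \<in> K \<Longrightarrow> (w j has_field_derivative (\<Sum>k\<in>UNIV. A j k z * w k z)) (at z within K)"
proof -
  obtain W where Wa: "\<And>n j. W n j a = w0 j" and Wc: "\<And>n j. continuous_on K (W n j)"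
    and Wd: "\<And>n j z. z \<in> K \<Longrightarrow>
      (W (Suc n) j has_field_derivative (\<Sum>k\<in>UNIV. A j k z * W n k z)) (at z within K)"
    by (rule picard_iterates_exist[where A = A and ?w0.0 = w0, OF assms(1,2) contA holA]) blast
  define D where "D n j z = W (Suc n) j z - W n j z" for n j z
  \<comment> \<open>The limit of the iterates, written as a telescoping series to which the
    Weierstrass M-test applies.\<close>
  define w where "w j z = W 0 j z + suminf (\<lambda>n. D n j z)" for j z
  have W_sum: "W n j z = W 0 j z + (\<Sum>m<n. D m j z)" for n j z
    by (induction n) (auto simp: D_def)
  have unif: "uniform_limit L (\<lambda>n. W n j) (w j) sequentially"
    and bdd: "\<exists>M\<ge>0. \<forall>j k. \<forall>z\<in>L. norm (A j k z) \<le> M"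
    if L: "compact L" "convex L" "a \<in> L" "L \<subseteq> K" for L j
  proof -
    obtain M where M: "0 \<le> M" "\<And>jk x. x \<in> L \<Longrightarrow> norm (A (fst jk) (snd jk) x) \<le> M"
      using finite_family_bounded[OF L(1), of "\<lambda>jk. A (fst jk) (snd jk)"]
        continuous_on_subset[OF contA L(4)] by auto
    then show "\<exists>M\<ge>0. \<forall>j k. \<forall>z\<in>L. norm (A j k z) \<le> M"
      by (intro exI[of _ M]) (auto dest: M(2)[of _ "(_, _)"])
    have "continuous_on L (D 0 j)" for j
      unfolding D_def by (intro continuous_intros continuous_on_subset[OF Wc L(4)])
    then obtain C where C: "0 \<le> C" "\<And>j x. x \<in> L \<Longrightarrow> norm (D 0 j x) \<le> C"
      using finite_family_bounded[OF L(1), of "D 0"] by auto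
    obtain R where R: "\<And>z. z \<in> L \<Longrightarrow> norm (z - a) \<le> R"
      using compact_imp_bounded[OF L(1)] bounded_any_center[of L a]
      by (auto simp: dist_norm norm_minus_commute)
    define q where "q = CARD('n) * M * R"
    have Db: "norm (D n j z) \<le> C * q ^ n / fact n" if "z \<in> L" for n j z
    proof -
      have "norm (D n j z) \<le> C * (CARD('n) * M * norm (z - a)) ^ n / fact n"
      proof (rule iterated_linear_ode_estimate[where K = L and A = A])
        show "(D (Suc n) j has_field_derivative (\<Sum>k\<in>UNIV. A j k z * D n k z)) (at z within L)"
          if "z \<in> L" for n j z
        proof -
          have "(D (Suc n) j has_field_derivative
             (\<Sum>k\<in>UNIV. A j k z * W (Suc n) k z) - (\<Sum>k\<in>UNIV. A j k z * W n k z)) (at z within K)"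
            unfolding D_def using that L by (intro DERIV_diff Wd) auto
          moreover have "(\<Sum>k\<in>UNIV. A j k z * W (Suc n) k z) - (\<Sum>k\<in>UNIV. A j k z * W n k z)
              = (\<Sum>k\<in>UNIV. A j k z * D n k z)"
            by (simp add: D_def right_diff_distrib sum_subtractf)
          ultimately show ?thesis
            using L(4) DERIV_subset by fastforce
        qed
      qed (use L M(1) M(2)[of _ "(_, _)"] C Wa that in \<open>auto simp: D_def\<close>)
      also have "\<dots> \<le> C * q ^ n / fact n"
        unfolding q_def using R[OF that] M(1) C(1)
        by (intro divide_right_mono mult_left_mono power_mono) auto
      finally show ?thesis .
    qed
    have "summable (\<lambda>n. C * q ^ n / fact n)"
      using summable_mult[OF summable_exp[of q], of C] by (simp add: field_simps)
    then have "uniform_limit L (\<lambda>n z. \<Sum>m<n. D m j z) (\<lambda>z. suminf (\<lambda>m. D m j z)) sequentially"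
      by (rule Weierstrass_m_test[rotated]) (rule Db)
    then have "uniform_limit L (\<lambda>n z. W 0 j z + (\<Sum>m<n. D m j z))
        (\<lambda>z. W 0 j z + suminf (\<lambda>m. D m j z)) sequentially"
      by (intro uniform_limit_add uniform_limit_const)
    then show "uniform_limit L (\<lambda>n. W n j) (w j) sequentially"
      by (simp only: W_sum[symmetric] w_def[symmetric])
  qed
  have wd: "(w j has_field_derivative (\<Sum>k\<in>UNIV. A j k z * w k z)) (at z within K)" if "z \<in> K" for j z
  proof -
    obtain e where e: "e > 0" "compact (K \<inter> cball z e)"
      using loc \<open>z \<in> K\<close> by blast
    \<comment> \<open>Adding \<open>a\<close> includes the point where all iterates agree. The hull
      stays in \<open>K\<close> by convexity and contains a neighbourhood of \<open>z\<close>
      relative to \<open>K\<close>, so derivatives at \<open>z\<close> within \<open>L\<close> and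
      within \<open>K\<close> coincide.\<close>
    define L where "L = convex hull (insert a (K \<inter> cball z e))"
    have L: "compact L" "convex L" "a \<in> L" "L \<subseteq> K" "z \<in> L" "K \<inter> ball z e \<subseteq> L"
      using e assms(1,2) \<open>z \<in> K\<close> unfolding L_def
      by (auto intro!: compact_convex_hull hull_inc simp: hull_minimal)
    obtain M where M: "M \<ge> 0" "\<And>j k z. z \<in> L \<Longrightarrow> norm (A j k z) \<le> M"
      using bdd[OF L(1-4)] by blast
    \<comment> \<open>The index is shifted because the derivative of an iterate is prescribed only
      from \<open>W 1\<close> on.\<close>
    have "\<exists>g. \<forall>x\<in>L. (\<lambda>n. W (Suc n) j x) \<longlonglongrightarrow> g x \<and>
        (g has_field_derivative (\<Sum>k\<in>UNIV. A j k x * w k x)) (at x within L)"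
    proof (rule has_complex_derivative_sequence[OF L(2)])
      show "(W (Suc n) j has_field_derivative (\<Sum>k\<in>UNIV. A j k x * W n k x)) (at x within L)"
        if "x \<in> L" for n x
        using Wd L(4) that by (meson DERIV_subset subsetD)
      show "\<exists>x l. x \<in> L \<and> (\<lambda>n. W (Suc n) j x) \<longlonglongrightarrow> l"
        using L(3) Wa by (intro exI[of _ a] exI[of _ "w0 j"]) auto
      fix r :: real assume "r > 0"
      \<comment> \<open>The summand 1 keeps the denominator positive when \<open>M\<close> is
        0.\<close>
      define d where "d = r / (CARD('n) * M + 1)"
      have "d > 0"
        using \<open>r > 0\<close> M by (simp add: d_def add_nonneg_pos)
      have "\<forall>\<^sub>F n in sequentially. \<forall>k. \<forall>x\<in>L. dist (W n k x) (w k x) < d"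
        by (intro eventually_all_finite uniform_limitD[OF unif] L \<open>d > 0\<close>)
      then obtain N where N: "\<And>n k x. n \<ge> N \<Longrightarrow> x \<in> L \<Longrightarrow> norm (W n k x - w k x) < d"
        by (auto simp: eventually_sequentially dist_norm)
      have "norm ((\<Sum>k\<in>UNIV. A j k x * W n k x) - (\<Sum>k\<in>UNIV. A j k x * w k x)) \<le> r"
        if "n \<ge> N" "x \<in> L" for n x
      proof -
        have "norm (\<Sum>k\<in>UNIV. A j k x * (W n k x - w k x)) \<le> (\<Sum>k\<in>(UNIV::'n set). M * d)"
          unfolding norm_mult using N[OF that, THEN less_imp_le] M that
          by (intro sum_norm_le) (auto simp only: norm_mult norm_ge_zero intro!: mult_mono)
        also have "\<dots> \<le> (CARD('n) * M + 1) * d"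
          using \<open>d > 0\<close> by (simp add: algebra_simps)
        also have "\<dots> = r"
        proof -
          have "CARD('n) * M + 1 > 0"
            using M(1) by (intro add_nonneg_pos mult_nonneg_nonneg) auto
          then show ?thesis
            by (simp add: d_def)
        qed
        finally show ?thesis
          by (simp add: right_diff_distrib sum_subtractf)
      qed
      then show "\<exists>N. \<forall>n x. n \<ge> N \<longrightarrow> x \<in> L \<longrightarrow>
          norm ((\<Sum>k\<in>UNIV. A j k x * W n k x) - (\<Sum>k\<in>UNIV. A j k x * w k x)) \<le> r"
        by blast
    qed
    then obtain g where g: "\<And>x. x \<in> L \<Longrightarrow> (\<lambda>n. W (Suc n) j x) \<longlonglongrightarrow> g x"
      "\<And>x. x \<in> L \<Longrightarrow> (g has_field_derivative (\<Sum>k\<in>UNIV. A j k x * w k x)) (at x within L)"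
      by blast
    have "g x = w j x" if "x \<in> L" for x
      using LIMSEQ_unique[OF g(1)[OF that]] tendsto_uniform_limitI[OF unif[OF L(1-4)] that]
        LIMSEQ_Suc by blast
    then have "(w j has_field_derivative (\<Sum>k\<in>UNIV. A j k z * w k z)) (at z within L)"
      by (intro has_field_derivative_transform_within[OF g(2)[OF L(5)] zero_less_one L(5)])
    moreover have "at z within L = at z within K"
      by (rule at_within_nhd[of z "ball z e"]) (use e L in auto)
    ultimately show ?thesis
      by simp
  qed
  have wa: "w j a = w0 j" for j
    by (simp add: w_def D_def Wa)
  show thesis
    by (rule that[of w]) (use wa wd in auto)
qed

section \<open>Null curves and minimal immersions\<close>

lemma has_derivative_vec:
  fixes g :: "'a::real_normed_vector \<Rightarrow> real^'n"
  assumes "\<And>i. ((\<lambda>x. g x $ i) has_derivative (\<lambda>h. g' h $ i)) (at z within S)"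
  shows "(g has_derivative g') (at z within S)"
  using assms by (subst has_derivative_componentwise_within) (auto simp: Basis_vec_def inner_axis)

lemma sum_Complex_squares:
  fixes u v :: "real^'n"
  shows "(\<Sum>i\<in>UNIV. (Complex (u $ i) (- (v $ i)))\<^sup>2) = Complex (u \<bullet> u - v \<bullet> v) (- 2 * (u \<bullet> v))"
  by (simp add: complex_eq_iff power2_eq_square inner_vec_def sum_subtractf sum_distrib_left
      flip: sum_negf)

text \<open>For the partial derivatives of a map X the left side is the bilinear square of X_x - i
  X_y. Its real part compares the lengths and its imaginary part is -2 times the inner product, so
  conformality is nullity of the complex gradient.\<close>

lemma null_vector_iff:
  fixes u v :: "real^'n"
  shows "(\<Sum>i\<in>UNIV. (Complex (u $ i) (- (v $ i)))\<^sup>2) = 0 \<longleftrightarrow> norm u = norm v \<and> u \<bullet> v = 0"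
  unfolding sum_Complex_squares by (auto simp: complex_eq_iff norm_eq)

text \<open>The y-derivative is kept in the form Re (i H'), so that the lemma applies again to
  \<open>dx X\<close> and \<open>dy X\<close>, with H' and i H' in place of \<open>H\<close>, and
  yields the second derivatives.\<close>

lemma Re_holomorphic_map:
  fixes H :: "3 \<Rightarrow> complex \<Rightarrow> complex"
  assumes "open S" and H: "\<And>i. H i holomorphic_on S"
    and X: "\<And>z. z \<in> S \<Longrightarrow> X z = (\<chi> i. Re (H i z))"
  shows "z \<in> S \<Longrightarrow> (X has_derivative (\<lambda>h. \<chi> i. Re (deriv (H i) z * h))) (at z)"
    and "z \<in> S \<Longrightarrow> dx X z = (\<chi> i. Re (deriv (H i) z))"
    and "z \<in> S \<Longrightarrow> dy X z = (\<chi> i. Re (\<i> * deriv (H i) z))"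
    and "C1_map_on X S"
proof -
  show D: "(X has_derivative (\<lambda>h. \<chi> i. Re (deriv (H i) z * h))) (at z)" if "z \<in> S" for z
  proof -
    have "((\<lambda>z. \<chi> i. Re (H i z)) has_derivative (\<lambda>h. \<chi> i. Re (deriv (H i) z * h))) (at z)"
    proof (rule has_derivative_vec, simp only: vec_lambda_beta)
      fix i
      have "(H i has_derivative (\<lambda>h. deriv (H i) z * h)) (at z)"
        using holomorphic_derivI[OF H \<open>open S\<close> that] by (simp add: has_field_derivative_def)
      then show "((\<lambda>x. Re (H i x)) has_derivative (\<lambda>h. Re (deriv (H i) z * h))) (at z)"
        by (rule has_derivative_Re)
    qed
    then show ?thesis
      using X \<open>open S\<close> that by (elim has_derivative_transform_within_open) auto
  qed
  show dx: "dx X z = (\<chi> i. Re (deriv (H i) z))" if "z \<in> S" for z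
    unfolding dx_def frechet_derivative_at[OF D[OF that], symmetric] by simp
  show dy: "dy X z = (\<chi> i. Re (\<i> * deriv (H i) z))" if "z \<in> S" for z
    unfolding dy_def frechet_derivative_at[OF D[OF that], symmetric] by (simp add: mult.commute)
  have dH: "continuous_on S (deriv (H i))" for i
    using holomorphic_deriv[OF H \<open>open S\<close>] holomorphic_on_imp_continuous_on by blast
  have "continuous_on S (\<lambda>z. \<chi> i. Re (deriv (H i) z))" "continuous_on S (\<lambda>z. \<chi> i. Re (\<i> * deriv (H i) z))"
    by (intro continuous_intros dH)+
  then have "continuous_on S (dx X)" "continuous_on S (dy X)"
    using dx dy by (simp_all cong: continuous_on_cong)
  moreover have "X differentiable_on S"
    unfolding differentiable_on_def using D differentiableI differentiable_at_withinI by blast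
  ultimately show "C1_map_on X S"
    using \<open>open S\<close> by (simp add: C1_map_on_def)
qed

text \<open>The derivative of \<open>H\<close> is X_x - i X_y. Its nullity is conformality; since
  null partials have equal length, its being nonzero makes \<open>dx X\<close> nonzero; real parts
  of holomorphic functions are harmonic.\<close>

lemma null_curve_minimal_immersion:
  fixes H :: "3 \<Rightarrow> complex \<Rightarrow> complex"
  assumes "open S" and H: "\<And>i. H i holomorphic_on S"
    and X: "\<And>z. z \<in> S \<Longrightarrow> X z = (\<chi> i. Re (H i z))"
    and null: "\<And>z. z \<in> S \<Longrightarrow> (\<Sum>i\<in>UNIV. (deriv (H i) z)\<^sup>2) = 0"
    and nonzero: "\<And>z. z \<in> S \<Longrightarrow> \<exists>i. deriv (H i) z \<noteq> 0"
  shows "minimal_immersion_on X S"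
proof -
  have dH: "deriv (H i) holomorphic_on S" "(\<lambda>z. \<i> * deriv (H i) z) holomorphic_on S" for i
    by (intro holomorphic_intros holomorphic_deriv H \<open>open S\<close>)+
  have dx: "dx X z = (\<chi> i. Re (deriv (H i) z))" if "z \<in> S" for z
    by (rule Re_holomorphic_map(2)[OF \<open>open S\<close> H X that])
  have dy: "dy X z = (\<chi> i. Re (\<i> * deriv (H i) z))" if "z \<in> S" for z
    by (rule Re_holomorphic_map(3)[OF \<open>open S\<close> H X that])
  have dxx: "dx (dx X) z = (\<chi> i. Re (deriv (deriv (H i)) z))" if "z \<in> S" for z
    by (rule Re_holomorphic_map(2)[where H = "\<lambda>i. deriv (H i)", OF \<open>open S\<close> dH(1) dx that])
  have dyy: "dy (dy X) z = (\<chi> i. Re (\<i> * deriv (\<lambda>z. \<i> * deriv (H i) z) z))" if "z \<in> S" for z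
    by (rule Re_holomorphic_map(3)[where H = "\<lambda>i z. \<i> * deriv (H i) z", OF \<open>open S\<close> dH(2) dy that])
  have C1: "C1_map_on X S" "C1_map_on (dx X) S" "C1_map_on (dy X) S"
    by (rule Re_holomorphic_map(4)[OF \<open>open S\<close> H X]
      Re_holomorphic_map(4)[where H = "\<lambda>i. deriv (H i)", OF \<open>open S\<close> dH(1) dx]
      Re_holomorphic_map(4)[where H = "\<lambda>i z. \<i> * deriv (H i) z", OF \<open>open S\<close> dH(2) dy]; assumption)+
  have "dx (dx X) z + dy (dy X) z = 0" if "z \<in> S" for z
  proof -
    have "deriv (\<lambda>z. \<i> * deriv (H i) z) z = \<i> * deriv (deriv (H i)) z" for i
      using dH(1) \<open>open S\<close> that holomorphic_on_imp_differentiable_at by (intro deriv_cmult) blast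
    then show ?thesis
      unfolding dxx[OF that] dyy[OF that] by (simp add: vec_eq_iff)
  qed
  moreover have "dx X z \<noteq> 0 \<and> norm (dx X z) = norm (dy X z) \<and> dx X z \<bullet> dy X z = 0" if "z \<in> S" for z
  proof -
    have c: "deriv (H i) z = Complex (dx X z $ i) (- (dy X z $ i))" for i
      unfolding dx[OF that] dy[OF that] by (simp add: complex_eq_iff)
    have n: "norm (dx X z) = norm (dy X z) \<and> dx X z \<bullet> dy X z = 0"
      using null[OF that] unfolding c null_vector_iff .
    moreover have "dx X z \<noteq> 0"
    proof
      assume "dx X z = 0"
      then have "dx X z = 0" "dy X z = 0"
        using n by auto
      then have "deriv (H i) z = 0" for i
        by (simp add: c zero_complex.code)
      then show False
        using nonzero[OF that] by blast
    qed
    ultimately show ?thesis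
      by simp
  qed
  ultimately show ?thesis
    using C1
    unfolding minimal_immersion_on_def harmonic_map_on_def conformal_immersion_on_def by blast
qed

lemma has_derivative_dx_dy:
  assumes "C1_map_on X S" "z \<in> S"
  shows "(X has_derivative (\<lambda>h. Re h *\<^sub>R dx X z + Im h *\<^sub>R dy X z)) (at z)"
proof -
  have "X differentiable at z"
    using assms differentiable_on_eq_differentiable_at unfolding C1_map_on_def by blast
  then have D: "(X has_derivative frechet_derivative X (at z)) (at z)"
    by (simp add: frechet_derivative_works)
  interpret linear "frechet_derivative X (at z)"
    using D has_derivative_linear by blast
  have "frechet_derivative X (at z) h = Re h *\<^sub>R dx X z + Im h *\<^sub>R dy X z" for h
  proof -
    have "frechet_derivative X (at z) (Re h *\<^sub>R 1 + Im h *\<^sub>R \<i>) = Re h *\<^sub>R dx X z + Im h *\<^sub>R dy X z"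
      by (simp only: add scaleR dx_def dy_def)
    moreover have "Re h *\<^sub>R 1 + Im h *\<^sub>R \<i> = h"
      by (simp add: complex_eq_iff)
    ultimately show ?thesis
      by simp
  qed
  then show ?thesis
    using D by presburger
qed

text \<open>Of the two Cauchy-Riemann equations for X_x - i X_y, one is the Laplace equation and the
  other is the symmetry of mixed derivatives.\<close>

lemma harmonic_map_gradient_holomorphic:
  assumes X: "harmonic_map_on X S"
  shows "(\<lambda>z. Complex (dx X z $ i) (- (dy X z $ i))) holomorphic_on S"
proof -
  have "open S" and C1: "C1_map_on X S" "C1_map_on (dx X) S" "C1_map_on (dy X) S"
    and lap: "\<And>z. z \<in> S \<Longrightarrow> dx (dx X) z + dy (dy X) z = 0"
    using X by (auto simp: harmonic_map_on_def C1_map_on_def)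
  have "\<exists>c. ((\<lambda>z. Complex (dx X z $ i) (- (dy X z $ i))) has_field_derivative c) (at z)" if "z \<in> S" for z
  proof -
    have comp: "((\<lambda>z. Y z $ i) has_derivative (\<lambda>h. Re h * dx Y z $ i + Im h * dy Y z $ i)) (at z)"
      if "C1_map_on Y S" "z \<in> S" for Y z
      using bounded_linear.has_derivative[OF bounded_linear_vec_nth has_derivative_dx_dy[OF that], of i] by simp
    define M where "M = (\<lambda>h. Re h * dx (dx X) z $ i + Im h * dy (dx X) z $ i)"
    define N where "N = (\<lambda>h. Re h * dx (dy X) z $ i + Im h * dy (dy X) z $ i)"
    have M: "((\<lambda>z. dx X z $ i) has_derivative M) (at z)" and N: "((\<lambda>z. dy X z $ i) has_derivative N) (at z)"
      using comp C1 that unfolding M_def N_def by auto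
    have "M \<i> = N 1"
      using mixed_derivatives_eq[OF \<open>open S\<close> that comp[OF C1(1)], of 1 M \<i> N] M N by simp
    then have mix: "dy (dx X) z $ i = dx (dy X) z $ i"
      by (simp add: M_def N_def)
    have lap': "dy (dy X) z $ i = - dx (dx X) z $ i"
      using lap[OF that] by (simp add: vec_eq_iff eq_neg_iff_add_eq_0 add.commute)
    have "((\<lambda>z. of_real (dx X z $ i) - \<i> * of_real (dy X z $ i)) has_derivative
        (\<lambda>h. of_real (M h) - \<i> * of_real (N h))) (at z)"
      by (intro derivative_intros M N)
    moreover have "(\<lambda>h. of_real (M h) - \<i> * of_real (N h)) = (*) (Complex (dx (dx X) z $ i) (- (dx (dy X) z $ i)))"
      by (auto simp: M_def N_def complex_eq_iff mix lap' algebra_simps)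
    moreover have "(\<lambda>z. of_real (dx X z $ i) - \<i> * of_real (dy X z $ i)) = (\<lambda>z. Complex (dx X z $ i) (- (dy X z $ i)))"
      by (auto simp: complex_eq_iff)
    ultimately show ?thesis
      unfolding has_field_derivative_def by metis
  qed
  then show ?thesis
    using \<open>open S\<close> by (simp add: holomorphic_on_open)
qed

section \<open>Free boundary data\<close>

lemma sum_UNIV_option: "sum g UNIV = g None + (\<Sum>i\<in>UNIV. g (Some i))" for g :: "3 option \<Rightarrow> complex"
  unfolding UNIV_option_conv by (subst sum.insert) (auto simp: sum.reindex)

definition upper :: "complex set \<Rightarrow> complex set" where
  "upper S = {z \<in> S. 0 < Im z}"

definition closed_upper :: "complex set \<Rightarrow> complex set" where
  "closed_upper S = {z \<in> S. 0 \<le> Im z}"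

definition equator :: "complex set \<Rightarrow> complex set" where
  "equator S = {z \<in> S. Im z = 0}"

text \<open>A common setting for both topological types: \<open>S\<close> will be the unit disk with
  \<open>T = 0\<close>, or a strip symmetric about the real axis. Convexity provides primitives, and
  the origin is the base point of the differential equation.\<close>

locale free_boundary_data =
  fixes S :: "complex set" and T :: real and \<Psi> U V :: "complex \<Rightarrow> real^3"
  assumes open_S: "open S" and convex_S: "convex S" and zero_in_S: "0 \<in> S"
    and cnj_S: "\<And>z. z \<in> S \<Longrightarrow> cnj z \<in> S"
    and add_S: "\<And>z. z \<in> S \<Longrightarrow> z + of_real T \<in> S"
    and diff_S: "\<And>z. z \<in> S \<Longrightarrow> z - of_real T \<in> S"
    and minimal: "minimal_immersion_on \<Psi> (upper S)"
    and periodic: "\<And>z. z \<in> closed_upper S \<Longrightarrow> \<Psi> (z + of_real T) = \<Psi> z"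
    and cont_U: "continuous_on (closed_upper S) U" and cont_V: "continuous_on (closed_upper S) V"
    and derivative: "\<And>z. z \<in> closed_upper S \<Longrightarrow>
      (\<Psi> has_derivative (\<lambda>h. Re h *\<^sub>R U z + Im h *\<^sub>R V z)) (at z within closed_upper S)"
    and on_sphere: "\<And>z. z \<in> equator S \<Longrightarrow> norm (\<Psi> z) = 1"
    and U_equator: "\<And>z. z \<in> equator S \<Longrightarrow> U z \<noteq> 0"
    and perpendicular: "\<And>z. z \<in> equator S \<Longrightarrow> \<Psi> z \<in> span {U z, V z}"
begin

abbreviation "D \<equiv> upper S"
abbreviation "K \<equiv> closed_upper S"
abbreviation "\<delta> \<equiv> equator S"

lemmas domain_defs = upper_def closed_upper_def equator_def

lemma K_eq: "K = D \<union> \<delta>"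
  by (auto simp: domain_defs)

lemma zero_in_K: "0 \<in> K" and zero_in_\<delta>: "0 \<in> \<delta>"
  using zero_in_S by (auto simp: domain_defs)

lemma D_subset_K: "D \<subseteq> K" and \<delta>_subset_K: "\<delta> \<subseteq> K"
  by (auto simp: domain_defs)

lemma open_D: "open D"
proof -
  have "D = S \<inter> {z. 0 < Im z}"
    by (auto simp: upper_def)
  then show ?thesis
    by (simp add: open_Int open_S open_halfspace_Im_gt)
qed

lemma convex_D: "convex D" and convex_K: "convex K" and convex_\<delta>: "convex \<delta>"
proof -
  have eq: "D = S \<inter> {z. 0 < Im z}" "K = S \<inter> {z. 0 \<le> Im z}" "\<delta> = S \<inter> {z. Im z = 0}"
    by (auto simp: domain_defs)
  have "convex {z. 0 < Im z}" "convex {z. 0 \<le> Im z}" "convex {z. Im z = 0}"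
    using convex_halfspace_Im_gt[of 0] convex_halfspace_Im_ge[of 0] convex_hyperplane[of "\<i>" 0]
    by (simp_all add: inner_complex_def)
  then show "convex D" "convex K" "convex \<delta>"
    unfolding eq by (auto intro!: convex_Int convex_S)
qed

lemma interior_K: "interior K = D"
proof
  show "D \<subseteq> interior K"
    by (simp add: interior_maximal D_subset_K open_D)
  have "interior K \<subseteq> interior {z. \<i> \<bullet> z \<ge> 0}"
    by (intro interior_mono) (auto simp: closed_upper_def inner_complex_def)
  also have "\<dots> = {z. 0 < Im z}"
    by (subst interior_halfspace_ge) (auto simp: inner_complex_def)
  finally show "interior K \<subseteq> D"
    using interior_subset[of K] by (auto simp: domain_defs)
qed

lemma islimpt_D: "z islimpt D" if "z \<in> K"
  unfolding islimpt_approachable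
proof (intro allI impI)
  fix e :: real assume "0 < e"
  obtain r where r: "r > 0" "ball z r \<subseteq> S"
    using open_contains_ball[of S] open_S \<open>z \<in> K\<close> by (auto simp: closed_upper_def)
  define h where "h = min r e / 2"
  have h: "0 < h" "h < r" "h < e"
    using r \<open>0 < e\<close> by (auto simp: h_def)
  have d: "dist (z + \<i> * of_real h) z = h"
    using h by (simp add: dist_norm norm_mult)
  have "z + \<i> * of_real h \<in> ball z r"
    using d h by (simp add: dist_commute)
  then have "z + \<i> * of_real h \<in> D"
    using r that h by (auto simp: domain_defs)
  then show "\<exists>x'\<in>D. x' \<noteq> z \<and> dist x' z < e"
    using h d by (intro bexI[of _ "z + \<i> * of_real h"]) auto
qed

lemma within_K_nontrivial: "at z within K \<noteq> bot" if "z \<in> K"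
  using islimpt_D[OF that] D_subset_K islimpt_subset trivial_limit_within by blast

text \<open>Every point of \<delta> is a limit of points of \<open>D\<close>. This carries
  identities such as the nullity and the periodicity of the complex gradient from the interior to
  the free boundary.\<close>

lemma continuous_extension_unique:
  fixes g h :: "complex \<Rightarrow> 'b::real_normed_vector"
  assumes "continuous_on K g" "continuous_on K h" and eq: "\<And>z. z \<in> D \<Longrightarrow> g z = h z" and "z \<in> K"
  shows "g z = h z"
proof -
  have "(g \<longlongrightarrow> g z) (at z within D)" "(h \<longlongrightarrow> h z) (at z within D)"
    using assms(1,2,4) tendsto_within_subset[OF _ D_subset_K] unfolding continuous_on_def by blast+
  moreover have "\<forall>\<^sub>F x in at z within D. g x = h x"
    using eq by (auto simp: eventually_at_filter)
  moreover have "at z within D \<noteq> bot"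
    using islimpt_D[OF \<open>z \<in> K\<close>] trivial_limit_within by blast
  ultimately show ?thesis
    by (metis tendsto_cong tendsto_unique)
qed

lemma add_K: "z + of_real T \<in> K" if "z \<in> K"
  using that add_S by (auto simp: domain_defs)

lemma add_D: "z + of_real T \<in> D" if "z \<in> D"
  using that add_S by (auto simp: domain_defs)

text \<open>Using \<open>U\<close> and \<open>V\<close> instead of \<open>dx\<close> and
  \<open>dy\<close> makes the complex gradient continuous up to \<delta>, where \<Psi> is assumed
  differentiable from one side only.\<close>

definition f :: "3 \<Rightarrow> complex \<Rightarrow> complex" where
  "f i z = Complex (U z $ i) (- (V z $ i))"

lemma derivative_D:
  assumes "z \<in> D"
  shows "(\<Psi> has_derivative (\<lambda>h. Re h *\<^sub>R U z + Im h *\<^sub>R V z)) (at z)"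
  using derivative[of z] at_within_interior[of z K] assms D_subset_K by (auto simp: interior_K)

lemma dx_\<Psi>: "dx \<Psi> z = U z" and dy_\<Psi>: "dy \<Psi> z = V z" if "z \<in> D"
  unfolding dx_def dy_def frechet_derivative_at[OF derivative_D[OF that], symmetric] by simp_all

lemma f_holomorphic: "f i holomorphic_on D"
proof -
  have "(\<lambda>z. Complex (dx \<Psi> z $ i) (- (dy \<Psi> z $ i))) holomorphic_on D"
    using minimal harmonic_map_gradient_holomorphic by (auto simp: minimal_immersion_on_def)
  then show ?thesis
    by (rule holomorphic_transform) (simp add: dx_\<Psi> dy_\<Psi> f_def)
qed

lemma f_continuous: "continuous_on K (f i)"
  unfolding f_def Complex_eq by (intro continuous_intros cont_U cont_V)

lemma f_null: "(\<Sum>i\<in>UNIV. (f i z)\<^sup>2) = 0" if "z \<in> K"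
proof (rule continuous_extension_unique[OF _ _ _ that])
  show "continuous_on K (\<lambda>z. \<Sum>i\<in>UNIV. (f i z)\<^sup>2)"
    by (intro continuous_intros f_continuous)
  show "(\<Sum>i\<in>UNIV. (f i z)\<^sup>2) = 0" if "z \<in> D" for z
    using minimal that unfolding f_def null_vector_iff
    by (auto simp: minimal_immersion_on_def conformal_immersion_on_def dx_\<Psi> dy_\<Psi>)
qed auto

lemma UV_orthogonal: "U z \<bullet> V z = 0" if "z \<in> K"
  using f_null[OF that] unfolding f_def null_vector_iff by auto

lemma U_nonzero: "U z \<noteq> 0" if "z \<in> K"
  using that minimal U_equator dx_\<Psi> unfolding K_eq
  by (auto simp: minimal_immersion_on_def conformal_immersion_on_def)

lemma f_nonzero: "\<exists>i. f i z \<noteq> 0" if "z \<in> K"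
  using U_nonzero[OF that] by (auto simp: f_def vec_eq_iff complex_eq_iff)

lemma f_periodic: "f i (z + of_real T) = f i z" if "z \<in> K"
proof (rule continuous_extension_unique[OF _ _ _ that])
  show "continuous_on K (\<lambda>z. f i (z + of_real T))"
    by (rule continuous_on_compose2[OF f_continuous]) (auto intro!: continuous_intros add_K)
  show "f i (z + of_real T) = f i z" if "z \<in> D" for z
  proof -
    have "((\<lambda>z. z + of_real T) has_derivative (\<lambda>h. h)) (at z)"
      by (auto intro!: derivative_eq_intros)
    from has_derivative_compose[OF this derivative_D[OF add_D[OF that]]]
    have "((\<lambda>z. \<Psi> (z + of_real T)) has_derivative
        (\<lambda>h. Re h *\<^sub>R U (z + of_real T) + Im h *\<^sub>R V (z + of_real T))) (at z)"
      by simp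
    then have "(\<Psi> has_derivative (\<lambda>h. Re h *\<^sub>R U (z + of_real T) + Im h *\<^sub>R V (z + of_real T))) (at z)"
      by (rule has_derivative_transform_within_open[OF _ open_D that])
        (use periodic D_subset_K in auto)
    from has_derivative_unique[OF this derivative_D[OF that]]
    have "Re h *\<^sub>R U (z + of_real T) + Im h *\<^sub>R V (z + of_real T) = Re h *\<^sub>R U z + Im h *\<^sub>R V z" for h
      by meson
    from this[of 1] this[of \<i>] show ?thesis
      by (simp add: f_def)
  qed
qed (rule f_continuous)

text \<open>The real part of a primitive of \<open>f i\<close> has the same derivative as the
  component of \<Psi>, so they differ by a real constant, which is subtracted. In the annular case
  \<open>F\<close> itself need not inherit the period; its real part does.\<close>

lemma primitive_exists:
  obtains F where "\<And>i z. z \<in> K \<Longrightarrow> (F i has_field_derivative f i z) (at z within K)"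
    "\<And>i z. z \<in> K \<Longrightarrow> Re (F i z) = \<Psi> z $ i"
proof -
  have "\<exists>G. (\<forall>z\<in>K. (G has_field_derivative f i z) (at z within K)) \<and> (\<forall>z\<in>K. Re (G z) = \<Psi> z $ i)" for i
  proof -
    obtain g where g: "\<And>z. z \<in> K \<Longrightarrow> (g has_field_derivative f i z) (at z within K)"
      by (rule holomorphic_convex_primitive[OF convex_K finite.emptyI f_continuous])
        (use holomorphic_on_imp_differentiable_at[OF f_holomorphic open_D] in \<open>auto simp: interior_K\<close>)
    have "\<exists>c. \<forall>z\<in>K. Re (g z) - \<Psi> z $ i = c"
    proof (rule has_derivative_zero_constant[OF convex_K])
      fix z assume z: "z \<in> K"
      have "((\<lambda>z. Re (g z)) has_derivative (\<lambda>h. Re (f i z * h))) (at z within K)"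
        using g[OF z] unfolding has_field_derivative_def by (rule has_derivative_Re)
      moreover have "((\<lambda>z. \<Psi> z $ i) has_derivative (\<lambda>h. (Re h *\<^sub>R U z + Im h *\<^sub>R V z) $ i)) (at z within K)"
        by (rule bounded_linear.has_derivative[OF bounded_linear_vec_nth derivative[OF z]])
      ultimately have "((\<lambda>z. Re (g z) - \<Psi> z $ i) has_derivative
          (\<lambda>h. Re (f i z * h) - (Re h *\<^sub>R U z + Im h *\<^sub>R V z) $ i)) (at z within K)"
        by (rule has_derivative_diff)
      moreover have "(\<lambda>h. Re (f i z * h) - (Re h *\<^sub>R U z + Im h *\<^sub>R V z) $ i) = (\<lambda>h. 0)"
        by (auto simp: f_def)
      ultimately show "((\<lambda>z. Re (g z) - \<Psi> z $ i) has_derivative (\<lambda>h. 0)) (at z within K)"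
        by simp
    qed
    then obtain c where c: "\<And>z. z \<in> K \<Longrightarrow> Re (g z) = \<Psi> z $ i + c"
      by (metis add.commute diff_eq_eq)
    show ?thesis
      by (rule exI[of _ "\<lambda>z. g z - of_real c"]) (use c in \<open>auto intro!: derivative_eq_intros g\<close>)
  qed
  then show thesis
    using that by metis
qed

section \<open>The conformal lift of the boundary curve\<close>

text \<open>The index \<open>None\<close> stands for the fourth coordinate \<open>s\<close> beside
  the vector \<open>p\<close>. Coupling the two blocks symmetrically through \<open>f\<close> puts
  the matrix into the Lie algebra of the complex orthogonal group of the form p . p - s^2.\<close>

definition lift_matrix :: "3 option \<Rightarrow> 3 option \<Rightarrow> complex \<Rightarrow> complex" where
  "lift_matrix j k z = (case (j, k) of (Some i, None) \<Rightarrow> f i z | (None, Some i) \<Rightarrow> f i z | _ \<Rightarrow> 0)"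

definition is_lift :: "(3 \<Rightarrow> complex \<Rightarrow> complex) \<Rightarrow> (complex \<Rightarrow> complex) \<Rightarrow> bool" where
  "is_lift p s \<longleftrightarrow>
    (\<forall>z\<in>K. (\<forall>i. (p i has_field_derivative f i z * s z) (at z within K)) \<and>
       (s has_field_derivative (\<Sum>i\<in>UNIV. f i z * p i z)) (at z within K))"

lemma lift_matrix_continuous: "continuous_on K (lift_matrix j k)"
  and lift_matrix_holomorphic: "lift_matrix j k holomorphic_on D"
  unfolding lift_matrix_def
  by (cases j; cases k; simp add: f_continuous f_holomorphic)+

lemma lift_matrix_sum:
  "(\<Sum>k\<in>UNIV. lift_matrix (Some i) k z * w k) = f i z * w None"
  "(\<Sum>k\<in>UNIV. lift_matrix None k z * w k) = (\<Sum>i\<in>UNIV. f i z * w (Some i))"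
  by (simp_all add: sum_UNIV_option lift_matrix_def)

lemma is_lift_iff:
  "is_lift p s \<longleftrightarrow> (\<forall>j. \<forall>z\<in>K. ((case j of None \<Rightarrow> s | Some i \<Rightarrow> p i) has_field_derivative
     (\<Sum>k\<in>UNIV. lift_matrix j k z * (case k of None \<Rightarrow> s | Some i \<Rightarrow> p i) z)) (at z within K))"
  unfolding is_lift_def split_option_all by (auto simp: lift_matrix_sum)

lemma lift_unique:
  assumes "is_lift p s" "a \<in> K" "\<And>i. p i a = 0" "s a = 0" "z \<in> K"
  shows "p i z = 0" "s z = 0"
proof -
  have "(case j of None \<Rightarrow> s | Some i \<Rightarrow> p i) z = 0" for j
  proof (rule linear_ode_unique[OF convex_K \<open>a \<in> K\<close> \<open>z \<in> K\<close>, where A = lift_matrix])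
    show "((case j of None \<Rightarrow> s | Some i \<Rightarrow> p i) has_field_derivative
      (\<Sum>k\<in>UNIV. lift_matrix j k z * (case k of None \<Rightarrow> s | Some i \<Rightarrow> p i) z)) (at z within K)"
      if "z \<in> K" for j z
      using assms(1) that unfolding is_lift_iff by blast
    show "(case j of None \<Rightarrow> s | Some i \<Rightarrow> p i) a = 0" for j
      by (simp add: assms(3,4) split: option.split)
  qed (rule lift_matrix_continuous)
  from this[of None] this[of "Some i"] show "p i z = 0" "s z = 0"
    by auto
qed

lemma lift_exists:
  obtains p s where "is_lift p s" "\<And>i. p i 0 = \<Psi> 0 $ i" "s 0 = 1"
proof -
  have loc: "\<exists>e>0. compact (K \<inter> cball z e)" if "z \<in> K" for z
  proof -
    obtain e where "e > 0" "cball z e \<subseteq> S"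
      using open_contains_cball[of S] open_S \<open>z \<in> K\<close> by (auto simp: closed_upper_def)
    moreover from this have "K \<inter> cball z e = {z. 0 \<le> Im z} \<inter> cball z e"
      by (auto simp: closed_upper_def)
    ultimately show ?thesis
      by (metis closed_Int_compact closed_halfspace_Im_ge compact_cball)
  qed
  \<comment> \<open>The initial vector (\<Psi> 0, 1) has quotient \<Psi> 0, and it is null for the
    form p . p - s^2 because \<Psi> 0 lies on the sphere.\<close>
  obtain w where w0: "\<And>j. w j 0 = (case j of None \<Rightarrow> 1 | Some i \<Rightarrow> of_real (\<Psi> 0 $ i))"
    and w: "\<And>j z. z \<in> K \<Longrightarrow>
      (w j has_field_derivative (\<Sum>k\<in>UNIV. lift_matrix j k z * w k z)) (at z within K)"
    by (rule linear_ode_exists[where A = lift_matrix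
          and ?w0.0 = "\<lambda>j. case j of None \<Rightarrow> 1 | Some i \<Rightarrow> of_real (\<Psi> 0 $ i)",
          OF convex_K zero_in_K loc lift_matrix_continuous])
      (auto simp: interior_K lift_matrix_holomorphic)
  have "is_lift (\<lambda>i. w (Some i)) (w None)"
    unfolding is_lift_def using w[of _ None] w[of _ "Some _"] by (auto simp: lift_matrix_sum)
  then show thesis
    by (rule that) (auto simp: w0)
qed

section \<open>The boundary curve and the free boundary condition\<close>

abbreviation \<psi> :: "3 \<Rightarrow> complex \<Rightarrow> complex" where
  "\<psi> i z \<equiv> of_real (\<Psi> z $ i)"

lemma islimpt_\<delta>: "z islimpt \<delta>" if "z \<in> \<delta>"
  unfolding islimpt_approachable
proof (intro allI impI)
  fix e :: real assume "0 < e"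
  obtain r where r: "r > 0" "ball z r \<subseteq> S"
    using open_contains_ball[of S] open_S \<open>z \<in> \<delta>\<close> by (auto simp: equator_def)
  define h where "h = min r e / 2"
  have h: "0 < h" "h < r" "h < e"
    using r \<open>0 < e\<close> by (auto simp: h_def)
  have d: "dist (z + of_real h) z = h"
    using h by (simp add: dist_norm)
  have "z + of_real h \<in> ball z r"
    using d h by (simp add: dist_commute)
  then have "z + of_real h \<in> \<delta>"
    using r that h by (auto simp: domain_defs)
  then show "\<exists>x'\<in>\<delta>. x' \<noteq> z \<and> dist x' z < e"
    using h d by (intro bexI[of _ "z + of_real h"]) auto
qed

lemma \<psi>_derivative: "(\<psi> i has_field_derivative of_real (U z $ i)) (at z within \<delta>)" if "z \<in> \<delta>"
proof -
  define A where "A h = complex_of_real ((Re h *\<^sub>R U z + Im h *\<^sub>R V z) $ i)" for h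
  have "((\<lambda>z. \<Psi> z $ i) has_derivative (\<lambda>h. (Re h *\<^sub>R U z + Im h *\<^sub>R V z) $ i)) (at z within \<delta>)"
    by (rule bounded_linear.has_derivative[OF bounded_linear_vec_nth
          has_derivative_subset[OF derivative \<delta>_subset_K]]) (use that \<delta>_subset_K in auto)
  then have "(\<psi> i has_derivative A) (at z within \<delta>)"
    unfolding A_def by (rule has_derivative_of_real)
  \<comment> \<open>Increments along \<delta> are real, so the \<open>V\<close> term drops out and
    the real-linear derivative acts as multiplication by \<open>U\<close>.\<close>
  moreover have "A (y - z) = of_real (U z $ i) * (y - z)" if "y \<in> \<delta>" for y
    using that \<open>z \<in> \<delta>\<close> by (simp add: A_def equator_def complex_eq_iff)
  ultimately show ?thesis
    unfolding has_field_derivative_def has_derivative_within_alt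
    by (simp add: bounded_linear_mult_right)
qed

lemma \<psi>_continuous: "continuous_on \<delta> (\<psi> i)"
  by (rule DERIV_continuous_on) (rule \<psi>_derivative)

lemma \<psi>_unit: "(\<Sum>i\<in>UNIV. (\<psi> i z)\<^sup>2) = 1" if "z \<in> \<delta>"
proof -
  have "\<Psi> z \<bullet> \<Psi> z = 1"
    using on_sphere[OF that] by (simp add: norm_eq_1)
  then have "of_real (\<Psi> z \<bullet> \<Psi> z) = (1 :: complex)"
    by simp
  then show ?thesis
    by (simp add: inner_vec_def power2_eq_square)
qed

text \<open>Differentiate \<psi> . \<psi> = 1 along \<delta>.\<close>

lemma U_orthogonal: "U z \<bullet> \<Psi> z = 0" if "z \<in> \<delta>"
proof -
  have "((\<lambda>z. \<Sum>i\<in>UNIV. (\<psi> i z)\<^sup>2) has_field_derivative (\<Sum>i\<in>UNIV. 2 * \<psi> i z * of_real (U z $ i)))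
      (at z within \<delta>)"
    by (auto intro!: derivative_eq_intros \<psi>_derivative that simp: ac_simps)
  moreover have "((\<lambda>z. \<Sum>i\<in>UNIV. (\<psi> i z)\<^sup>2) has_field_derivative 0) (at z within \<delta>)"
    using \<psi>_unit that by (intro has_field_derivative_transform_within[OF DERIV_const zero_less_one that]) auto
  moreover have "at z within \<delta> \<noteq> bot"
    using islimpt_\<delta>[OF that] trivial_limit_within by blast
  ultimately have "(\<Sum>i\<in>UNIV. 2 * \<psi> i z * of_real (U z $ i)) = 0"
    by (rule has_field_derivative_unique)
  then have "of_real (2 * (U z \<bullet> \<Psi> z)) = (0 :: complex)"
    by (simp add: inner_vec_def sum_distrib_left ac_simps)
  then show ?thesis
    unfolding of_real_eq_0_iff by simp
qed

text \<open>Perpendicularity puts \<Psi> into the span of \<open>U\<close> and \<open>V\<close>.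
  Since \<open>U\<close> is nonzero and orthogonal to both \<open>V\<close> and \<Psi>, its
  coefficient vanishes, so \<Psi> is a nonzero multiple of \<open>V\<close>.\<close>

lemma V_normal: "V z = (V z \<bullet> \<Psi> z) *\<^sub>R \<Psi> z" if "z \<in> \<delta>"
proof -
  obtain a b where ab: "\<Psi> z = a *\<^sub>R U z + b *\<^sub>R V z"
    using perpendicular[OF \<open>z \<in> \<delta>\<close>] by (auto simp: span_insert span_singleton algebra_simps)
  have "U z \<bullet> \<Psi> z = a * (U z \<bullet> U z) + b * (U z \<bullet> V z)"
    unfolding ab by (simp add: inner_add_right)
  then have "a = 0"
    using U_orthogonal[OF that] UV_orthogonal[of z] U_equator[OF that] that \<delta>_subset_K by auto
  then have "\<Psi> z = b *\<^sub>R V z"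
    using ab by simp
  moreover have "\<Psi> z \<bullet> \<Psi> z = 1"
    using on_sphere[OF that] by (simp add: norm_eq_1)
  ultimately have "b * (V z \<bullet> \<Psi> z) = 1"
    by (metis inner_scaleR_left)
  then have "(V z \<bullet> \<Psi> z) *\<^sub>R \<Psi> z = ((V z \<bullet> \<Psi> z) * b) *\<^sub>R V z"
    using \<open>\<Psi> z = b *\<^sub>R V z\<close> by (metis scaleR_scaleR)
  then show ?thesis
    using \<open>b * (V z \<bullet> \<Psi> z) = 1\<close> by (simp add: mult.commute)
qed

lemma f_equator: "f i z = of_real (U z $ i) - \<i> * of_real (V z \<bullet> \<Psi> z) * \<psi> i z" if "z \<in> \<delta>"
proof -
  have "V z $ i = (V z \<bullet> \<Psi> z) * \<Psi> z $ i"
    using V_normal[OF that] by (metis real_scaleR_def vector_scaleR_component)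
  then show ?thesis
    by (simp add: f_def complex_eq_iff)
qed

lemma f_\<psi>_equator: "(\<Sum>i\<in>UNIV. f i z * \<psi> i z) = - \<i> * of_real (V z \<bullet> \<Psi> z)" if "z \<in> \<delta>"
  using U_orthogonal[OF that] by (simp add: f_def complex_eq_iff inner_vec_def sum_negf)

text \<open>On \<delta> the free boundary condition reads f = \<psi>' + (f . \<psi>) \<psi>. Hence
  the defect e = p - s \<psi> solves the homogeneous linear system e' = -(f . e) \<psi> with e = 0
  at the origin, and uniqueness along \<delta> applies.\<close>

lemma lift_equator:
  assumes "is_lift p s" "\<And>i. p i 0 = \<psi> i 0" "s 0 = 1" "z \<in> \<delta>"
  shows "p i z = s z * \<psi> i z"
proof -
  have "p i z - s z * \<psi> i z = 0"
  proof (rule linear_ode_unique[OF convex_\<delta> zero_in_\<delta> \<open>z \<in> \<delta>\<close>,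
        where A = "\<lambda>i k z. - (f k z * \<psi> i z)" and w = "\<lambda>i z. p i z - s z * \<psi> i z"])
    fix i z assume z: "z \<in> \<delta>"
    have p: "(p i has_field_derivative f i z * s z) (at z within \<delta>)"
      and s: "(s has_field_derivative (\<Sum>i\<in>UNIV. f i z * p i z)) (at z within \<delta>)"
      using assms(1) z \<delta>_subset_K unfolding is_lift_def by (blast intro: DERIV_subset)+
    define c where "c = (\<Sum>i\<in>UNIV. f i z * p i z)"
    define l where "l = \<i> * of_real (V z \<bullet> \<Psi> z)"
    have "((\<lambda>z. p i z - s z * \<psi> i z) has_field_derivative
        f i z * s z - (c * \<psi> i z + s z * of_real (U z $ i))) (at z within \<delta>)"
      unfolding c_def by (auto intro!: derivative_eq_intros p s \<psi>_derivative[OF z])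
    moreover have "(\<Sum>k\<in>UNIV. - (f k z * \<psi> i z) * (p k z - s z * \<psi> k z)) =
        - \<psi> i z * c + \<psi> i z * s z * (\<Sum>k\<in>UNIV. f k z * \<psi> k z)"
      unfolding c_def by (simp add: sum_distrib_left algebra_simps sum_subtractf sum_negf)
    moreover have "\<dots> = f i z * s z - (c * \<psi> i z + s z * of_real (U z $ i))"
      by (simp only: f_\<psi>_equator[OF z]) (simp add: f_equator[OF z] algebra_simps)
    ultimately show "((\<lambda>z. p i z - s z * \<psi> i z) has_field_derivative
        (\<Sum>k\<in>UNIV. - (f k z * \<psi> i z) * (p k z - s z * \<psi> k z))) (at z within \<delta>)"
      by (simp only:)
  next
    show "continuous_on \<delta> (\<lambda>z. - (f k z * \<psi> i z))" for i k
      by (intro continuous_intros \<psi>_continuous continuous_on_subset[OF f_continuous \<delta>_subset_K])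
  qed (simp add: assms)
  then show ?thesis
    by simp
qed

end

section \<open>The reflected surface\<close>

locale reflected_surface = free_boundary_data +
  fixes F p :: "3 \<Rightarrow> complex \<Rightarrow> complex" and s :: "complex \<Rightarrow> complex"
  assumes F: "\<And>i z. z \<in> K \<Longrightarrow> (F i has_field_derivative f i z) (at z within K)"
    and Re_F: "\<And>i z. z \<in> K \<Longrightarrow> Re (F i z) = \<Psi> z $ i"
    and lift: "is_lift p s" and p_0: "\<And>i. p i 0 = \<psi> i 0" and s_0: "s 0 = 1"
begin

lemma p_derivative: "z \<in> K \<Longrightarrow> (p i has_field_derivative f i z * s z) (at z within K)"
  and s_derivative: "z \<in> K \<Longrightarrow> (s has_field_derivative (\<Sum>i\<in>UNIV. f i z * p i z)) (at z within K)"
  using lift by (auto simp: is_lift_def)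

lemma F_continuous: "continuous_on K (F i)"
  and p_continuous: "continuous_on K (p i)" and s_continuous: "continuous_on K s"
  by (rule DERIV_continuous_on, erule F p_derivative s_derivative)+

text \<open>Both p . p and s^2 have derivative 2 s (f . p), so their difference is constant; at the
  origin it is |\<Psi> 0|^2 - 1 = 0.\<close>

lemma lift_null: "(\<Sum>i\<in>UNIV. (p i z)\<^sup>2) = (s z)\<^sup>2" if "z \<in> K"
proof -
  have "\<exists>c. \<forall>z\<in>K. (\<Sum>i\<in>UNIV. (p i z)\<^sup>2) - (s z)\<^sup>2 = c"
  proof (rule has_field_derivative_zero_constant[OF convex_K])
    show "((\<lambda>z. (\<Sum>i\<in>UNIV. (p i z)\<^sup>2) - (s z)\<^sup>2) has_field_derivative 0) (at z within K)"
      if "z \<in> K" for z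
      by (auto intro!: derivative_eq_intros p_derivative s_derivative that
          simp: sum_distrib_left sum_distrib_right ac_simps)
  qed
  then have "(\<Sum>i\<in>UNIV. (p i z)\<^sup>2) - (s z)\<^sup>2 = (\<Sum>i\<in>UNIV. (p i 0)\<^sup>2) - (s 0)\<^sup>2"
    using that zero_in_K by metis
  also have "\<dots> = 0"
    using \<psi>_unit[OF zero_in_\<delta>] by (simp add: p_0 s_0)
  finally show ?thesis
    by simp
qed

text \<open>By uniqueness a common zero of \<open>p\<close> and \<open>s\<close> would make the lift
  vanish identically, against \<open>s 0 = 1\<close>. Zeros of \<open>s\<close> are therefore
  genuine poles of the quotient.\<close>

lemma lift_nonzero: "\<exists>i. p i z \<noteq> 0" if "z \<in> K" "s z = 0"
  using lift_unique(2)[OF lift that(1) _ that(2) zero_in_K] s_0 by auto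

lemma s_equator: "s z \<noteq> 0" if "z \<in> \<delta>"
  using lift_nonzero[of z] lift_equator[OF lift p_0 s_0 that] that \<delta>_subset_K by auto

text \<open>Division by zero yields 0 at the zeros of \<open>s\<close>; the mirror images of these
  points form \<open>P\<close> and are removed from the domain.\<close>

definition \<gamma> :: "3 \<Rightarrow> complex \<Rightarrow> complex" where
  "\<gamma> i z = p i z / s z"

definition G :: "3 \<Rightarrow> complex \<Rightarrow> complex" where
  "G i z = 2 * \<gamma> i z - F i z"

definition H :: "3 \<Rightarrow> complex \<Rightarrow> complex" where
  "H i z = (if 0 \<le> Im z then F i z else cnj (G i (cnj z)))"

definition P :: "complex set" where
  "P = {z \<in> S. Im z < 0 \<and> s (cnj z) = 0}"

definition X :: "complex \<Rightarrow> real^3" where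
  "X z = (\<chi> i. Re (H i z))"

lemma \<gamma>_unit: "(\<Sum>i\<in>UNIV. (\<gamma> i z)\<^sup>2) = 1" if "z \<in> K" "s z \<noteq> 0"
  using lift_null[OF that(1)] that(2)
  by (simp add: \<gamma>_def power_divide flip: sum_divide_distrib)

lemma \<gamma>_equator: "\<gamma> i z = \<psi> i z" if "z \<in> \<delta>"
  using lift_equator[OF lift p_0 s_0 that] s_equator[OF that] by (simp add: \<gamma>_def)

text \<open>On \<delta> the quotient \<gamma> is real and equals the real part of \<open>F\<close>,
  so 2 \<gamma> - F is the conjugate of \<open>F\<close>. This is the matching condition for the
  reflection.\<close>

lemma G_equator: "cnj (G i z) = F i z" if "z \<in> \<delta>"
  using that \<delta>_subset_K \<gamma>_equator[OF that] Re_F[of z i] by (auto simp: G_def complex_eq_iff)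

lemma G_continuous: "continuous_on {z \<in> K. s z \<noteq> 0} (G i)"
proof -
  have "{z \<in> K. s z \<noteq> 0} \<subseteq> K"
    by blast
  then show ?thesis
    unfolding G_def \<gamma>_def
    by (auto intro!: continuous_intros intro: continuous_on_subset F_continuous p_continuous s_continuous)
qed

text \<open>
  The derivative of \<open>G\<close> is the image of \<open>f\<close> under the complex reflection in the unit vector \<open>\<gamma>\<close>,
  hence again null and nonzero.
\<close>

definition g :: "3 \<Rightarrow> complex \<Rightarrow> complex" where
  "g i z = f i z - 2 * (\<Sum>k\<in>UNIV. f k z * \<gamma> k z) * \<gamma> i z"

text \<open>The quotient rule applied to the lift gives the Riccati equation \<gamma>' = f - (f .
  \<gamma>) \<gamma>; doubling it and subtracting F' = f leaves \<open>g\<close>.\<close>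

lemma G_derivative: "(G i has_field_derivative g i z) (at z)" if "z \<in> D" "s z \<noteq> 0"
proof -
  have K: "z \<in> K" and at: "at z within K = at z"
    using that D_subset_K at_within_interior[of z K] by (auto simp: interior_K)
  have "(\<gamma> i has_field_derivative
      (f i z * s z * s z - p i z * (\<Sum>k\<in>UNIV. f k z * p k z)) / (s z * s z)) (at z)"
    unfolding \<gamma>_def using p_derivative[OF K] s_derivative[OF K] that(2) unfolding at
    by (intro DERIV_divide)
  moreover have "(F i has_field_derivative f i z) (at z)"
    using F[OF K] unfolding at .
  ultimately have "(G i has_field_derivative
      2 * ((f i z * s z * s z - p i z * (\<Sum>k\<in>UNIV. f k z * p k z)) / (s z * s z)) - f i z) (at z)"
    unfolding G_def by (intro DERIV_diff DERIV_cmult)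
  moreover have "(\<Sum>k\<in>UNIV. f k z * \<gamma> k z) = (\<Sum>k\<in>UNIV. f k z * p k z) / s z"
    by (simp add: \<gamma>_def sum_divide_distrib)
  then have "2 * ((f i z * s z * s z - p i z * (\<Sum>k\<in>UNIV. f k z * p k z)) / (s z * s z)) - f i z = g i z"
    using that(2) by (simp add: g_def \<gamma>_def field_simps)
  ultimately show ?thesis
    by simp
qed

lemma g_null: "(\<Sum>i\<in>UNIV. (g i z)\<^sup>2) = 0" and g_nonzero: "\<exists>i. g i z \<noteq> 0"
  if "z \<in> K" "s z \<noteq> 0"
proof -
  define c where "c = (\<Sum>k\<in>UNIV. f k z * \<gamma> k z)"
  have "(\<Sum>i\<in>UNIV. (g i z)\<^sup>2) =
      (\<Sum>i\<in>UNIV. (f i z)\<^sup>2 - 4 * c * (f i z * \<gamma> i z) + 4 * c\<^sup>2 * (\<gamma> i z)\<^sup>2)"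
    unfolding g_def c_def[symmetric] by (simp add: power2_eq_square algebra_simps)
  also have "\<dots> = (\<Sum>i\<in>UNIV. (f i z)\<^sup>2) - 4 * c * c + 4 * c\<^sup>2 * (\<Sum>i\<in>UNIV. (\<gamma> i z)\<^sup>2)"
    by (simp only: sum.distrib sum_subtractf flip: sum_distrib_left c_def)
  finally show "(\<Sum>i\<in>UNIV. (g i z)\<^sup>2) = 0"
    using f_null[OF that(1)] \<gamma>_unit[OF that] by (simp add: power2_eq_square)
  show "\<exists>i. g i z \<noteq> 0"
  proof (rule ccontr)
    assume "\<nexists>i. g i z \<noteq> 0"
    then have "g i z = 0" for i
      by blast
    then have f: "f i z = 2 * c * \<gamma> i z" for i
      unfolding g_def c_def[symmetric] by (simp only: right_minus_eq)
    \<comment> \<open>Pairing f = 2 c \<gamma> with the unit vector \<gamma> gives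
      \<open>c = 2 * c\<close>, so \<open>c\<close>, and with it \<open>f\<close>, would
      vanish.\<close>
    have "c = (\<Sum>i\<in>UNIV. (2 * c * \<gamma> i z) * \<gamma> i z)"
      unfolding f[symmetric] by (rule c_def)
    also have "\<dots> = 2 * c * (\<Sum>i\<in>UNIV. (\<gamma> i z)\<^sup>2)"
      by (simp add: sum_distrib_left power2_eq_square ac_simps)
    also have "\<dots> = 2 * c"
      using \<gamma>_unit[OF that] by simp
    finally have "c = 0"
      by simp
    then show False
      using f f_nonzero[OF that(1)] by simp
  qed
qed

end

text \<open>For one complex number a, Re (a v) Re (a w) is |a|^2 (v . w) / 2 plus Re (a^2 v w) / 2.
  Summed over the coordinates of a null vector the second terms cancel, so the real part of a null
  curve induces a multiple of the flat metric.\<close>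

lemma inner_Re_null_vector:
  fixes c :: "'n::finite \<Rightarrow> complex"
  assumes "(\<Sum>i\<in>UNIV. (c i)\<^sup>2) = 0"
  shows "(\<chi> i. Re (c i * v)) \<bullet> (\<chi> i. Re (c i * w)) = (\<Sum>i\<in>UNIV. (norm (c i))\<^sup>2) / 2 * (v \<bullet> w)"
proof -
  have eq: "Re (c i * v) * Re (c i * w) = (norm (c i))\<^sup>2 / 2 * (v \<bullet> w) + Re ((c i)\<^sup>2 * (v * w)) / 2" for i
    unfolding cmod_power2 by (simp add: inner_complex_def power2_eq_square field_simps)
  have "(\<Sum>i\<in>UNIV. Re ((c i)\<^sup>2 * (v * w))) = Re ((\<Sum>i\<in>UNIV. (c i)\<^sup>2) * (v * w))"
    by (simp only: Re_sum sum_distrib_right)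
  then have "(\<Sum>i\<in>UNIV. Re ((c i)\<^sup>2 * (v * w))) = 0"
    by (simp add: assms)
  then show ?thesis
    unfolding inner_vec_def vec_lambda_beta inner_real_def eq sum.distrib
    by (simp flip: sum_divide_distrib sum_distrib_right)
qed

text \<open>The real part of c . c = 1 says |Re c|^2 - |Im c|^2 = 1, so |c|^2 = 2 |Re c|^2 - 1. Thus
  a pole of \<gamma> cannot hide in the imaginary part.\<close>

lemma norm_le_norm_Re_unit_vector:
  fixes c :: "'n::finite \<Rightarrow> complex"
  assumes "(\<Sum>i\<in>UNIV. (c i)\<^sup>2) = 1"
  shows "norm (c j) \<le> 2 * norm (\<chi> i. Re (c i))"
proof -
  have "(\<Sum>i\<in>UNIV. Re ((c i)\<^sup>2)) = 1"
    using assms by (metis Re_sum one_complex.simps(1))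
  then have re: "(\<Sum>i\<in>UNIV. (Re (c i))\<^sup>2 - (Im (c i))\<^sup>2) = 1"
    by (simp add: power2_eq_square)
  have "(norm (c j))\<^sup>2 \<le> (\<Sum>i\<in>UNIV. (norm (c i))\<^sup>2)"
    by (intro member_le_sum) auto
  also have "\<dots> = 2 * (\<Sum>i\<in>UNIV. (Re (c i))\<^sup>2) - (\<Sum>i\<in>UNIV. (Re (c i))\<^sup>2 - (Im (c i))\<^sup>2)"
    by (simp add: cmod_power2 sum.distrib sum_subtractf)
  also have "(\<Sum>i\<in>UNIV. (Re (c i))\<^sup>2) = (norm (\<chi> i. Re (c i)))\<^sup>2"
    unfolding power2_norm_eq_inner by (simp add: inner_vec_def power2_eq_square)
  also have "2 * (norm (\<chi> i. Re (c i)))\<^sup>2 - (\<Sum>i\<in>UNIV. (Re (c i))\<^sup>2 - (Im (c i))\<^sup>2)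
      \<le> 2 * (norm (\<chi> i. Re (c i)))\<^sup>2"
    unfolding re by simp
  also have "\<dots> \<le> (2 * norm (\<chi> i. Re (c i)))\<^sup>2"
    by (simp add: power_mult_distrib)
  finally show ?thesis
    by (rule power2_le_imp_le) simp
qed

lemma add_image_eq:
  fixes B :: "complex set"
  assumes "\<And>z. z \<in> B \<Longrightarrow> z + t \<in> B" "\<And>z. z \<in> B \<Longrightarrow> z - t \<in> B"
  shows "(\<lambda>z. z + t) ` B = B"
proof
  show "B \<subseteq> (\<lambda>z. z + t) ` B"
    using assms(2) by (auto intro!: image_eqI[of _ _ "_ - t"])
qed (use assms(1) in auto)

section \<open>Gluing the null curve and its reflection across the free boundary\<close>

context reflected_surface
begin

lemma mirror_D: "cnj ` D = {z \<in> S. Im z < 0}"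
proof
  show "{z \<in> S. Im z < 0} \<subseteq> cnj ` D"
    using cnj_S by (auto simp: upper_def intro!: image_eqI[of _ cnj "cnj _"])
qed (use cnj_S in \<open>auto simp: upper_def\<close>)

lemma P_subset: "P \<subseteq> cnj ` D"
  unfolding mirror_D by (auto simp: P_def)

lemma domain_eq: "D \<union> \<delta> \<union> (cnj ` D - P) = S - P"
  unfolding mirror_D by (auto simp: domain_defs P_def)

lemma K_subset: "K \<subseteq> S - P"
  by (auto simp: domain_defs P_def)

definition L :: "complex set" where
  "L = {z \<in> S. Im z \<le> 0}"

lemma cnj_L: "cnj z \<in> K" if "z \<in> L"
  using that cnj_S by (auto simp: L_def closed_upper_def)

text \<open>As \<open>s\<close> has no zeros on \<delta>, the strict inequality in \<open>P\<close>
  may be weakened. This exhibits \<open>P\<close> as the zero set of a continuous function on the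
  relatively closed lower half \<open>L\<close>, hence as relatively closed in
  \<open>S\<close>.\<close>

lemma P_eq: "P = {z \<in> L. s (cnj z) = 0}"
proof -
  have "s (cnj z) \<noteq> 0" if "z \<in> S" "Im z = 0" for z
    using s_equator[of "cnj z"] that cnj_S by (auto simp: equator_def)
  then show ?thesis
    by (auto simp: P_def L_def less_le)
qed

lemma open_domain: "open (S - P)"
proof -
  have "continuous_on L (\<lambda>z. s (cnj z))"
    by (rule continuous_on_compose2[OF s_continuous]) (auto intro!: continuous_intros cnj_L)
  then have "closedin (top_of_set L) {z \<in> L. s (cnj z) = 0}"
    by (rule continuous_closedin_preimage_constant)
  moreover have "L = S \<inter> {z. Im z \<le> 0}"
    by (auto simp: L_def)
  then have "closedin (top_of_set S) L"
    by (metis closed_halfspace_Im_le closedin_closed_Int)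
  ultimately have "closedin (top_of_set S) P"
    unfolding P_eq by (rule closedin_trans)
  then have "openin (top_of_set S) (S - P)"
    by (simp add: openin_diff)
  then show ?thesis
    using open_S openin_open_eq by blast
qed

text \<open>The two pieces are relatively closed, and on their overlap \<delta> the definitions
  agree by \<open>G_equator\<close>.\<close>

lemma H_continuous: "continuous_on (S - P) (H i)"
proof -
  have SP: "S - P = K \<union> (L - P)"
    by (auto simp: domain_defs L_def P_def)
  have 1: "K = (S - P) \<inter> {z. 0 \<le> Im z}" "L - P = (S - P) \<inter> {z. Im z \<le> 0}"
    by (auto simp: domain_defs L_def P_def)
  have 2: "closedin (top_of_set (S - P)) K" "closedin (top_of_set (S - P)) (L - P)"
    by (metis 1 closed_halfspace_Im_ge closedin_closed_Int) (metis 1 closed_halfspace_Im_le closedin_closed_Int)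
  have "continuous_on (L - P) (\<lambda>z. G i (cnj z))"
    by (rule continuous_on_compose2[OF G_continuous])
      (auto intro!: continuous_intros cnj_L simp: P_eq)
  then have c: "continuous_on (L - P) (\<lambda>z. cnj (G i (cnj z)))"
    by (intro continuous_intros)
  have "F i z = cnj (G i (cnj z))" if "z \<in> K \<and> \<not> 0 \<le> Im z \<or> z \<in> L - P \<and> 0 \<le> Im z" for z
  proof -
    have "z \<in> \<delta>"
      using that by (auto simp: domain_defs L_def)
    moreover from this have "cnj z = z"
      by (simp add: equator_def complex_eq_iff)
    ultimately show ?thesis
      using G_equator by simp
  qed
  then show ?thesis
    using 2 F_continuous c unfolding SP H_def by (intro continuous_on_cases_local) auto
qed

lemma H_derivative_D: "(H i has_field_derivative f i z) (at z)" if "z \<in> D"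
proof -
  have "(F i has_field_derivative f i z) (at z)"
    using F[of z i] that D_subset_K at_within_interior[of z K] by (auto simp: interior_K)
  then show ?thesis
    by (rule has_field_derivative_transform_within_open[OF _ open_D that])
      (simp add: H_def upper_def)
qed

lemma H_derivative_mirror: "(H i has_field_derivative cnj (g i (cnj z))) (at z)" if "z \<in> cnj ` D - P"
proof -
  have "cnj z \<in> D" "s (cnj z) \<noteq> 0" "z \<in> {z. Im z < 0}"
    using that by (auto simp: P_def mirror_D upper_def cnj_S)
  then have "(cnj \<circ> G i \<circ> cnj has_field_derivative cnj (g i (cnj z))) (at z)"
    by (intro has_field_derivative_cnj_cnj G_derivative)
  then show ?thesis
    by (rule has_field_derivative_transform_within_open[OF _ open_halfspace_Im_lt \<open>z \<in> {z. Im z < 0}\<close>])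
      (simp add: H_def)
qed

text \<open>The reflection principle: a continuous function that is holomorphic on both sides of the
  real axis is holomorphic across it.\<close>

lemma H_holomorphic: "H i holomorphic_on (S - P)"
proof (rule holomorphic_on_paste_across_line[where d = \<i> and k = 0])
  have "(S - P) \<inter> {z. \<i> \<bullet> z < 0} \<subseteq> cnj ` D - P"
    by (auto simp: mirror_D inner_complex_def)
  then show "H i holomorphic_on (S - P) \<inter> {z. \<i> \<bullet> z < 0}"
    using H_derivative_mirror field_differentiable_at_within unfolding holomorphic_on_def field_differentiable_def
    by (meson has_field_derivative_at_within subsetD)
  have "(S - P) \<inter> {z. 0 < \<i> \<bullet> z} \<subseteq> D"
    by (auto simp: upper_def inner_complex_def)
  then show "H i holomorphic_on (S - P) \<inter> {z. 0 < \<i> \<bullet> z}"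
    using H_derivative_D unfolding holomorphic_on_def field_differentiable_def
    by (meson has_field_derivative_at_within subsetD)
qed (use open_domain H_continuous in auto)

lemma deriv_H_mirror: "deriv (H i) z = cnj (g i (cnj z))" if "z \<in> cnj ` D - P"
  using H_derivative_mirror[OF that] by (rule DERIV_imp_deriv)

text \<open>At points of \<delta> pasting yields only the existence of the derivative; comparison
  with the one-sided derivative of \<open>F\<close> within \<open>K\<close> identifies it.\<close>

lemma deriv_H_K: "deriv (H i) z = f i z" if "z \<in> K"
proof (rule has_field_derivative_unique)
  show "(H i has_field_derivative deriv (H i) z) (at z within K)"
    using holomorphic_derivI[OF H_holomorphic open_domain] K_subset that
    by (meson has_field_derivative_at_within subsetD)
  show "(H i has_field_derivative f i z) (at z within K)"
    by (rule has_field_derivative_transform_within[OF F[OF that] zero_less_one that])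
      (simp add: H_def closed_upper_def)
qed (rule within_K_nontrivial[OF that])

lemma deriv_H_null: "(\<Sum>i\<in>UNIV. (deriv (H i) z)\<^sup>2) = 0" and deriv_H_nonzero: "\<exists>i. deriv (H i) z \<noteq> 0"
  if "z \<in> S - P"
proof -
  consider "z \<in> K" | "z \<in> cnj ` D - P"
    using \<open>z \<in> S - P\<close> unfolding mirror_D by (force simp: domain_defs)
  then show "(\<Sum>i\<in>UNIV. (deriv (H i) z)\<^sup>2) = 0" "\<exists>i. deriv (H i) z \<noteq> 0"
  proof (atomize (full), cases)
    case 1
    then show "(\<Sum>i\<in>UNIV. (deriv (H i) z)\<^sup>2) = 0 \<and> (\<exists>i. deriv (H i) z \<noteq> 0)"
      using f_null f_nonzero by (simp add: deriv_H_K)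
  next
    case 2
    then have z: "cnj z \<in> K" "s (cnj z) \<noteq> 0"
      by (auto simp: mirror_D P_def closed_upper_def cnj_S)
    have "(\<Sum>i\<in>UNIV. (deriv (H i) z)\<^sup>2) = cnj (\<Sum>i\<in>UNIV. (g i (cnj z))\<^sup>2)"
      using 2 by (simp add: deriv_H_mirror)
    then show "(\<Sum>i\<in>UNIV. (deriv (H i) z)\<^sup>2) = 0 \<and> (\<exists>i. deriv (H i) z \<noteq> 0)"
      using g_null[OF z] g_nonzero[OF z] 2 by (simp add: deriv_H_mirror)
  qed
qed

lemma X_minimal: "minimal_immersion_on X (S - P)"
  by (rule null_curve_minimal_immersion[OF open_domain H_holomorphic])
    (auto simp: X_def deriv_H_null deriv_H_nonzero)

section \<open>Values and periodicity of the continued surface\<close>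

lemma X_K: "X z = \<Psi> z" if "z \<in> K"
  using Re_F[OF that] that by (auto simp: X_def H_def closed_upper_def vec_eq_iff)

text \<open>Here \<open>F\<close> enters only through its real part \<Psi>, so periods of the
  imaginary part of \<open>F\<close> cannot obstruct the periodicity of \<open>X\<close>.\<close>

lemma X_mirror: "X z = 2 *\<^sub>R (\<chi> i. Re (\<gamma> i (cnj z))) - \<Psi> (cnj z)" if "z \<in> cnj ` D"
  using that Re_F[of "cnj z"] by (auto simp: X_def H_def G_def domain_defs vec_eq_iff)

text \<open>Since \<open>f\<close> is periodic, the translated lift is again a lift. At the origin
  it equals \<open>s (of_real T)\<close> times the original, by \<open>lift_equator\<close> and the
  periodicity of \<Psi>; uniqueness spreads this to \<open>K\<close>. The common multiplier cancels
  in \<gamma>.\<close>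

lemma lift_add:
  assumes "z \<in> K"
  shows "p i (z + of_real T) = s (of_real T) * p i z" "s (z + of_real T) = s (of_real T) * s z"
proof -
  have T: "of_real T \<in> \<delta>"
    using add_S[OF zero_in_S] by (auto simp: equator_def)
  have shift: "((\<lambda>z. h (z + of_real T)) has_field_derivative h') (at z within K)"
    if "(h has_field_derivative h') (at (z + of_real T) within K)" for h h' z
  proof -
    have "(h has_field_derivative h') (at (z + of_real T) within (\<lambda>z. z + of_real T) ` K)"
      by (rule DERIV_subset[OF that]) (auto intro: add_K)
    moreover have "((\<lambda>z. z + of_real T) has_field_derivative 1) (at z within K)"
      by (auto intro!: derivative_eq_intros)
    ultimately show ?thesis
      using DERIV_image_chain[of h h' "\<lambda>z. z + of_real T" z K 1] by (simp add: o_def)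
  qed
  have L: "is_lift (\<lambda>i z. p i (z + of_real T) - s (of_real T) * p i z) (\<lambda>z. s (z + of_real T) - s (of_real T) * s z)"
    unfolding is_lift_def
  proof (intro ballI allI conjI)
    fix z i assume z: "z \<in> K"
    have "((\<lambda>z. p i (z + of_real T) - s (of_real T) * p i z) has_field_derivative
        f i (z + of_real T) * s (z + of_real T) - s (of_real T) * (f i z * s z)) (at z within K)"
      by (intro DERIV_diff DERIV_cmult shift p_derivative z add_K)
    then show "((\<lambda>z. p i (z + of_real T) - s (of_real T) * p i z) has_field_derivative
        f i z * (s (z + of_real T) - s (of_real T) * s z)) (at z within K)"
      by (simp add: f_periodic[OF z] algebra_simps)
  next
    fix z assume z: "z \<in> K"
    have "((\<lambda>z. s (z + of_real T) - s (of_real T) * s z) has_field_derivative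
        (\<Sum>i\<in>UNIV. f i (z + of_real T) * p i (z + of_real T)) - s (of_real T) * (\<Sum>i\<in>UNIV. f i z * p i z))
        (at z within K)"
      by (intro DERIV_diff DERIV_cmult shift s_derivative z add_K)
    then show "((\<lambda>z. s (z + of_real T) - s (of_real T) * s z) has_field_derivative
        (\<Sum>i\<in>UNIV. f i z * (p i (z + of_real T) - s (of_real T) * p i z))) (at z within K)"
      by (simp add: f_periodic[OF z] sum_distrib_left sum_subtractf algebra_simps)
  qed
  have "p i (0 + of_real T) - s (of_real T) * p i 0 = 0" for i
    using lift_equator[OF lift p_0 s_0 T] periodic[OF zero_in_K] by (simp add: p_0)
  moreover have "s (0 + of_real T) - s (of_real T) * s 0 = 0"
    by (simp add: s_0)
  ultimately have "p i (z + of_real T) - s (of_real T) * p i z = 0" "s (z + of_real T) - s (of_real T) * s z = 0"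
    using lift_unique[OF L zero_in_K _ _ assms] by auto
  then show "p i (z + of_real T) = s (of_real T) * p i z" "s (z + of_real T) = s (of_real T) * s z"
    by auto
qed

lemma s_T: "s (of_real T) \<noteq> 0"
  using s_equator[of "of_real T"] add_S[OF zero_in_S] by (auto simp: equator_def)

lemma \<gamma>_add: "\<gamma> i (z + of_real T) = \<gamma> i z" if "z \<in> K"
  using that s_T by (simp add: \<gamma>_def lift_add)

lemma add_P: "z + of_real T \<in> P" if "z \<in> P"
  using that lift_add(2)[of "cnj z"] cnj_L[of z] add_S[of z] by (auto simp: P_eq L_def)

lemma diff_P: "z - of_real T \<in> P" if "z \<in> P"
proof -
  have "z - of_real T \<in> L"
    using that diff_S by (auto simp: P_def L_def)
  moreover from this have "s (cnj (z - of_real T)) = 0"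
    using lift_add(2)[of "cnj (z - of_real T)"] cnj_L[of "z - of_real T"] that s_T by (auto simp: P_def)
  ultimately show ?thesis
    by (simp add: P_eq)
qed

lemma P_shift: "(\<lambda>z. z + of_real T) ` P = P"
  by (intro add_image_eq add_P diff_P)

lemma X_periodic: "periodic_on T X (S - P)"
proof -
  have "z + of_real T \<in> S - P \<and> z - of_real T \<in> S - P" if "z \<in> S - P" for z
    using that add_S diff_S add_P[of "z - of_real T"] diff_P[of "z + of_real T"] by auto
  then have "(\<lambda>z. z + of_real T) ` (S - P) = S - P"
    by (intro add_image_eq) auto
  moreover have "X (z + of_real T) = X z" if "z \<in> S - P" for z
  proof (cases "z \<in> K")
    case True
    then show ?thesis
      by (simp add: X_K add_K periodic)
  next
    case False
    then have "z \<in> cnj ` D" "z + of_real T \<in> cnj ` D" "cnj z \<in> K"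
      using that add_S unfolding mirror_D by (auto simp: closed_upper_def cnj_S)
    then show ?thesis
      by (simp add: X_mirror \<gamma>_add periodic)
  qed
  ultimately show ?thesis
    by (simp add: periodic_on_def)
qed

section \<open>Discreteness of the punctures and ends\<close>

lemma s_eventually_nonzero: "\<forall>\<^sub>F w in at z. s w \<noteq> 0 \<and> w \<in> D" if "z \<in> D"
proof -
  have "s holomorphic_on D"
    using s_derivative D_subset_K at_within_interior[of _ K] unfolding holomorphic_on_def field_differentiable_def interior_K
    by (metis has_field_derivative_at_within subsetD)
  \<comment> \<open>If \<open>s\<close> vanished on all of \<open>D\<close>, continuity would give
    \<open>s 0 = 0\<close>. So \<open>s\<close> is not identically zero on the connected set
    \<open>D\<close>, and its zeros there are isolated.\<close>
  moreover obtain b where "b \<in> D" "s b \<noteq> 0"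
    using continuous_extension_unique[OF s_continuous continuous_on_const _ zero_in_K, of 0] s_0 by auto
  ultimately show ?thesis
    using non_zero_neighbour_alt[OF _ open_D convex_connected[OF convex_D] that] by blast
qed

lemma filterlim_cnj_at: "filterlim cnj (at (cnj z)) (at z)"
  unfolding filterlim_at by (auto simp: eventually_at_filter intro!: tendsto_intros)

lemma P_discrete: "\<not> z islimpt P" if "z \<in> cnj ` D"
proof -
  have "cnj z \<in> D"
    using that by auto
  then have "\<forall>\<^sub>F w in at z. s (cnj w) \<noteq> 0 \<and> cnj w \<in> D"
    using filterlim_cnj_at[of z] s_eventually_nonzero unfolding filterlim_iff by blast
  then have "\<forall>\<^sub>F w in at z. w \<notin> P"
    by eventually_elim (auto simp: P_def)
  then show ?thesis
    by (simp add: islimpt_iff_eventually)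
qed

text \<open>At a zero of \<open>s\<close> some \<open>p j\<close> is nonzero, so that component of
  \<gamma> has a pole. The unit condition passes the growth on to the real part of \<gamma>, while
  \<Psi> stays bounded near the point.\<close>

lemma P_end: "end_at X q" if "q \<in> P"
proof -
  define z where "z = cnj q"
  have "z \<in> D" "s z = 0"
    using that P_subset by (auto simp: z_def P_def)
  then have z: "z \<in> D" "s z = 0" "z \<in> K"
    using D_subset_K by auto
  obtain j where j: "p j z \<noteq> 0"
    using lift_nonzero[OF z(3,2)] by blast
  have at: "at z within K = at z"
    using z at_within_interior[of z K] by (simp add: interior_K)
  have lim: "(p j \<longlongrightarrow> p j z) (at z)" "(s \<longlongrightarrow> 0) (at z)" "(\<Psi> \<longlongrightarrow> \<Psi> z) (at z)"
    using p_continuous[of j] s_continuous z has_derivative_continuous[OF derivative_D[OF z(1)]] at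
    unfolding continuous_on_def continuous_within by metis+
  have "filterlim s (at 0) (at z)"
    using lim(2) s_eventually_nonzero[OF z(1)] by (auto simp: filterlim_at elim: eventually_mono)
  then have "filterlim (\<gamma> j) at_infinity (at z)"
    unfolding \<gamma>_def using lim(1) j by (intro filterlim_divide_at_infinity)
  then have "LIM w at z. norm (\<gamma> j w) :> at_top"
    by (rule filterlim_compose[OF filterlim_norm_at_top])
  then have "LIM w at z. - norm (\<Psi> w) + norm (\<gamma> j w) :> at_top"
    by (rule filterlim_tendsto_add_at_top[OF tendsto_minus[OF tendsto_norm[OF lim(3)]]])
  moreover have "\<forall>\<^sub>F w in at z. - norm (\<Psi> w) + norm (\<gamma> j w) \<le> norm (X (cnj w))"
    using s_eventually_nonzero[OF z(1)]
  proof eventually_elim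
    case (elim w)
    then have "norm (\<gamma> j w) \<le> 2 * norm (\<chi> i. Re (\<gamma> i w))"
      using D_subset_K by (intro norm_le_norm_Re_unit_vector \<gamma>_unit) auto
    moreover have "X (cnj w) = 2 *\<^sub>R (\<chi> i. Re (\<gamma> i w)) - \<Psi> w"
      using elim by (simp add: X_mirror)
    moreover have "norm (2 *\<^sub>R (\<chi> i. Re (\<gamma> i w))) - norm (\<Psi> w) \<le> norm (2 *\<^sub>R (\<chi> i. Re (\<gamma> i w)) - \<Psi> w)"
      by (rule norm_triangle_ineq2)
    ultimately show ?case
      by simp
  qed
  ultimately have "LIM w at z. norm (X (cnj w)) :> at_top"
    by (rule filterlim_at_top_mono)
  then have "LIM w at q. norm (X (cnj (cnj w))) :> at_top"
    using filterlim_compose[OF _ filterlim_cnj_at[of q]] unfolding z_def by blast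
  then show ?thesis
    unfolding end_at_def by (simp add: filterlim_norm_at_top_imp_at_infinity)
qed

text \<open>Complex conjugation itself is the equivalence: both parametrizations induce multiples of
  the flat metric, which conjugation preserves, and conjugation commutes with the real translation
  by \<open>T\<close>.\<close>

lemma mirror_conformal:
  "conformally_equivalent T (spherical_mirror_image D P X) (with_punctures (D, \<Psi>) (cnj ` P))"
  unfolding conformally_equivalent_def spherical_mirror_image_def with_punctures_def fst_conv snd_conv
proof (rule exI[of _ cnj], intro conjI disjI1 ballI)
  let ?A = "cnj ` D - P" and ?B = "D - cnj ` P"
  have AB: "cnj ` ?A = ?B" "cnj ` ?B = ?A"
    by (simp_all add: image_set_diff image_image inj_on_def)
  have "homeomorphism ?A ?B cnj cnj"
    unfolding homeomorphism_def using AB by (auto intro!: continuous_intros)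
  then show "homeomorphism ?A ?B cnj (inv_into ?A cnj)"
  proof (rule homeomorphism_cong)
    show "inv_into ?A cnj y = cnj y" if "y \<in> ?B" for y
      using that AB(2) by (intro inv_into_f_eq) (auto simp: inj_on_def)
  qed auto
  fix z assume z: "z \<in> ?A"
  then have zD: "cnj z \<in> D"
    by auto
  have zP: "z \<in> S - P"
    using z by (auto simp: mirror_D)
  have \<Psi>: "frechet_derivative \<Psi> (at (cnj z)) = (\<lambda>v. \<chi> i. Re (f i (cnj z) * v))"
    unfolding frechet_derivative_at[OF derivative_D[OF zD], symmetric] by (auto simp: f_def vec_eq_iff)
  have X: "frechet_derivative X (at z) = (\<lambda>v. \<chi> i. Re (deriv (H i) z * v))"
    using frechet_derivative_at[OF Re_holomorphic_map(1)[OF open_domain H_holomorphic X_def zP]] by simp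
  define a where "a = (\<Sum>i\<in>UNIV. (norm (f i (cnj z)))\<^sup>2) / 2"
  define b where "b = (\<Sum>i\<in>UNIV. (norm (deriv (H i) z))\<^sup>2) / 2"
  have pos: "a > 0" "b > 0"
  proof -
    obtain i j where "f i (cnj z) \<noteq> 0" "deriv (H j) z \<noteq> 0"
      using f_nonzero[of "cnj z"] zD D_subset_K deriv_H_nonzero[OF zP] by blast
    then show "a > 0" "b > 0"
      unfolding a_def b_def by (intro divide_pos_pos sum_pos2[of _ i] sum_pos2[of _ j]; simp)+
  qed
  have a: "frechet_derivative \<Psi> (at (cnj z)) v \<bullet> frechet_derivative \<Psi> (at (cnj z)) w = a * (v \<bullet> w)" for v w
    unfolding \<Psi> a_def using f_null[of "cnj z"] zD D_subset_K by (intro inner_Re_null_vector) auto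
  have b: "frechet_derivative X (at z) v \<bullet> frechet_derivative X (at z) w = b * (v \<bullet> w)" for v w
    unfolding X b_def by (intro inner_Re_null_vector deriv_H_null zP)
  show "\<exists>A c. (cnj has_derivative A) (at z) \<and> 0 < c \<and>
      (\<forall>v w. frechet_derivative \<Psi> (at (cnj z)) (A v) \<bullet> frechet_derivative \<Psi> (at (cnj z)) (A w) =
         c * (frechet_derivative X (at z) v \<bullet> frechet_derivative X (at z) w))"
    \<comment> \<open>The conformal factor is the quotient of the factors of the two induced metrics
      relative to the flat one.\<close>
    using pos by (intro exI[of _ cnj] exI[of _ "a / b"])
      (auto simp: a b inner_complex_def intro: bounded_linear_imp_has_derivative bounded_linear_cnj)
qed simp

lemma spherical_reflection:
  "analytic_continuation D \<delta> T \<Psi> P X \<and> (\<forall>q\<in>P. end_at X q) \<and>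
   punctures T D (cnj ` P) \<and> (cnj ` P = {} \<longleftrightarrow> P = {}) \<and>
   conformally_equivalent T (spherical_mirror_image D P X) (with_punctures (D, \<Psi>) (cnj ` P))"
proof -
  have "\<not> z islimpt cnj ` P" if "z \<in> D" for z
  proof -
    have "\<forall>\<^sub>F w in at (cnj z). w \<notin> P"
      using P_discrete[of "cnj z"] that by (simp add: islimpt_iff_eventually)
    then have "\<forall>\<^sub>F w in at z. cnj w \<notin> P"
      using filterlim_cnj_at[of z] unfolding filterlim_iff by blast
    then show ?thesis
      unfolding islimpt_iff_eventually not_not by eventually_elim auto
  qed
  moreover have "(\<lambda>z. z + of_real T) ` cnj ` P = cnj ` (\<lambda>z. z + of_real T) ` P"
    by (simp add: image_image)
  moreover have "cnj ` P \<subseteq> D"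
    using P_subset by auto
  ultimately have "punctures T D (cnj ` P)"
    by (simp add: punctures_def P_shift)
  moreover have "punctures T (cnj ` D) P"
    using P_subset P_discrete P_shift by (simp add: punctures_def)
  ultimately show ?thesis
    using X_minimal X_K X_periodic P_end mirror_conformal
    unfolding analytic_continuation_def domain_eq by (auto simp: K_eq)
qed

end

section \<open>Existence of the reflection for disks and annuli\<close>

context free_boundary_data
begin

lemma spherical_reflection_exists:
  "\<exists>P \<Psi>1.
     analytic_continuation D \<delta> T \<Psi> P \<Psi>1 \<and>
     (\<forall>p\<in>P. end_at \<Psi>1 p) \<and>
     (\<exists>Q. punctures T D Q \<and> (Q = {} \<longleftrightarrow> P = {}) \<and>
          conformally_equivalent T (spherical_mirror_image D P \<Psi>1) (with_punctures (D, \<Psi>) Q))"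
proof -
  obtain F where F: "\<And>i z. z \<in> K \<Longrightarrow> (F i has_field_derivative f i z) (at z within K)"
    "\<And>i z. z \<in> K \<Longrightarrow> Re (F i z) = \<Psi> z $ i"
    using primitive_exists by blast
  obtain p s where ps: "is_lift p s" "\<And>i. p i 0 = \<psi> i 0" "s 0 = 1"
    using lift_exists by blast
  interpret reflected_surface S T \<Psi> U V F p s
    by unfold_locales (use F ps in auto)
  show ?thesis
    using spherical_reflection by blast
qed

end

theorem theorem3p1:
  fixes D \<delta> :: "complex set" and T :: real and \<Psi> :: "complex \<Rightarrow> real^3"
  assumes "free_boundary_minimal_surface D \<delta> T \<Psi>"
    and "\<Psi> ` D \<subseteq> cball 0 1 \<or> \<Psi> ` D \<subseteq> - ball 0 1"
  shows "\<exists>P \<Psi>1.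
           analytic_continuation D \<delta> T \<Psi> P \<Psi>1 \<and>
           (\<forall>p\<in>P. end_at \<Psi>1 p) \<and>
           (\<exists>Q. punctures T D Q \<and> (Q = {} \<longleftrightarrow> P = {}) \<and>
                conformally_equivalent T (spherical_mirror_image D P \<Psi>1)
                  (with_punctures (D, \<Psi>) Q))"
proof -
  \<comment> \<open>The two topological types are reduced to one: \<delta> cuts a convex open set,
    symmetric under conjugation and invariant under translation by \<open>T\<close>, into
    \<open>D\<close> and its mirror image. This set is \<open>ball 0 1\<close> for the half disk and
    the doubled strip for the annulus.\<close>
  have "\<exists>S. D = upper S \<and> \<delta> = equator S \<and> open S \<and> convex S \<and> 0 \<in> S \<and>
      (\<forall>z\<in>S. cnj z \<in> S \<and> z + of_real T \<in> S \<and> z - of_real T \<in> S) \<and>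
      minimal_immersion_on \<Psi> D \<and> (\<forall>z\<in>closed_upper S. \<Psi> (z + of_real T) = \<Psi> z) \<and>
      free_boundary D \<delta> \<Psi>"
    using assms(1) unfolding free_boundary_minimal_surface_def
  proof (elim disjE exE conjE)
    assume eq: "D = half_disk" "\<delta> = half_disk_diameter" "T = 0"
      and sc: "simply_connected_free_boundary \<Psi>"
    show ?thesis
      by (rule exI[of _ "ball 0 1"])
        (use sc in \<open>auto simp: eq simply_connected_free_boundary_def upper_def equator_def
          half_disk_def half_disk_diameter_def\<close>)
  next
    fix a
    assume eq: "D = strip a" "\<delta> = strip_bottom" and dc: "doubly_connected_free_boundary a T \<Psi>"
    have "0 < a"
      using dc by (simp add: doubly_connected_free_boundary_def)
    have S: "{z. \<bar>Im z\<bar> < a} = {z. - a < Im z} \<inter> {z. Im z < a}"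
      by auto
    have "open {z. \<bar>Im z\<bar> < a}" "convex {z. \<bar>Im z\<bar> < a}"
      unfolding S by (intro open_Int open_halfspace_Im_gt open_halfspace_Im_lt
        convex_Int convex_halfspace_Im_gt convex_halfspace_Im_lt)+
    moreover have "strip a = upper {z. \<bar>Im z\<bar> < a}" "strip_bottom = equator {z. \<bar>Im z\<bar> < a}"
      "closed_upper {z. \<bar>Im z\<bar> < a} = strip a \<union> strip_bottom"
      using \<open>0 < a\<close> by (auto simp: strip_def strip_bottom_def upper_def equator_def closed_upper_def)
    ultimately show ?thesis
      by (intro exI[of _ "{z. \<bar>Im z\<bar> < a}"])
        (use dc in \<open>simp add: eq doubly_connected_free_boundary_def periodic_on_def\<close>)
  qed
  then obtain S where S: "D = upper S" "\<delta> = equator S" "open S" "convex S" "0 \<in> S"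
    "\<And>z. z \<in> S \<Longrightarrow> cnj z \<in> S \<and> z + of_real T \<in> S \<and> z - of_real T \<in> S"
    "minimal_immersion_on \<Psi> D" "\<And>z. z \<in> closed_upper S \<Longrightarrow> \<Psi> (z + of_real T) = \<Psi> z"
    "free_boundary D \<delta> \<Psi>"
    by blast
  have K: "closed_upper S = D \<union> \<delta>"
    by (auto simp: S(1,2) upper_def equator_def closed_upper_def)
  obtain U V where UV: "continuous_on (D \<union> \<delta>) U" "continuous_on (D \<union> \<delta>) V"
    "\<And>z. z \<in> D \<union> \<delta> \<Longrightarrow> (\<Psi> has_derivative (\<lambda>h. Re h *\<^sub>R U z + Im h *\<^sub>R V z)) (at z within D \<union> \<delta>)"
    "\<And>z. z \<in> \<delta> \<Longrightarrow> \<Psi> z \<in> sphere 0 1 \<and> U z \<noteq> 0 \<and> \<Psi> z \<in> span {U z, V z}"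
    using S(9) unfolding free_boundary_def by blast
  interpret free_boundary_data S T \<Psi> U V
  proof unfold_locales
    show "minimal_immersion_on \<Psi> (upper S)"
      using S(1,7) by simp
    show "(\<Psi> has_derivative (\<lambda>h. Re h *\<^sub>R U z + Im h *\<^sub>R V z)) (at z within closed_upper S)"
      if "z \<in> closed_upper S" for z
      using UV(3) that unfolding K by blast
  qed (use S UV in \<open>auto simp: K\<close>)
  show ?thesis
    unfolding S(1,2) by (rule spherical_reflection_exists)
qed

end
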